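(* Let $s\ge r\ge 0$ with $s\ge 1$, and let $F$ be the $2$-regular graph whose cycles are: one cycle of length $h\ge 3$, one cycle of length $2\ell_i$ for each $1\le i\le r$, and two cycles of length $\ell_j$ for each $r+1\le j\le s$, where all $\ell_i$ ($1\le i\le s$) are odd, $3\le\ell_1<\ell_2<\dots<\ell_r$, and $\ell_j\ge 3$ for $r+1\le j\le s$. Let $v$ be the order of $F$ and $\ell=\max\{\ell_i\mid 1\le i\le s\}$. If $h>7^{s-1}(12\ell+6)$, then for every $\sigma\in\{-1,0,1\}$ with $v-1\equiv\sigma\pmod 2$, $OP^\sigma(F)$ has a $(1-\sigma)$-pyramidal solution.
   Context: For $\sigma\in\{-1,0,1\}$ with $v-1\equiv\sigma\pmod 2$, $(K_v)^\sigma$ denotes $K_v-I'$ if $\sigma=-1$, $K_v$ if $\sigma=0$, and $K_v+I'$ if $\sigma=1$, where $I'$ is a $1$-factor of $K_v$ and $K_v+I'$ is $K_v$ with the edges of $I'$ doubled. A solution to $OP^\sigma(F)$ is an $F$-factorization of $(K_v)^\sigma$ (for some $1$-factor $I'$): a collection of spanning subgraphs isomorphic to $F$ whose edge multisets partition the edge multiset of $(K_v)^\sigma$. A solution is $f$-pyramidal if it admits a group of automorphisms (vertex permutations mapping each factor onto a factor) fixing exactly $f$ vertices and acting sharply transitively on the remaining vertices. *)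

theory Defs
  imports "HOL-Library.Multiset" "HOL-Number_Theory.Cong" "HOL-Algebra.Bij"
begin

text \<open>A simple graph is a pair (vertex set, edge set) whose edges are two-element vertex sets.
  A loopless multigraph on a given vertex set is represented by its multiset of edges.\<close>

type_synonym 'a graph = "'a set \<times> 'a set set"

abbreviation verts :: "'a graph \<Rightarrow> 'a set" where "verts \<equiv> fst"
abbreviation edges :: "'a graph \<Rightarrow> 'a set set" where "edges \<equiv> snd"

definition isomorphic :: "'a graph \<Rightarrow> 'b graph \<Rightarrow> bool" where
  "isomorphic F G \<longleftrightarrow>
     (\<exists>\<phi>. bij_betw \<phi> (verts F) (verts G) \<and> edges G = (\<lambda>e. \<phi> ` e) ` edges F)"

text \<open>The vertex-disjoint union of cycles of the lengths listed in \<open>ns\<close> (all at least 3);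
  the vertex \<open>(i, x)\<close> is the \<open>x\<close>-th vertex of the \<open>i\<close>-th cycle.\<close>

definition cycle_union :: "nat list \<Rightarrow> (nat \<times> nat) graph" where
  "cycle_union ns =
     (SIGMA i:{..<length ns}. {..<ns ! i},
      {{(i, x), (i, Suc x mod (ns ! i))} | i x. i < length ns \<and> x < ns ! i})"

definition complete_edges :: "'a set \<Rightarrow> 'a set set" where
  "complete_edges V = {e. e \<subseteq> V \<and> card e = 2}"

definition one_factor :: "'a set \<Rightarrow> 'a set set \<Rightarrow> bool" where
  "one_factor V I \<longleftrightarrow> I \<subseteq> complete_edges V \<and> (\<forall>x\<in>V. \<exists>!e. e \<in> I \<and> x \<in> e)"

text \<open>\<open>K_sigma V \<sigma> E\<close>: \<open>E\<close> is the edge multiset of \<open>(K\<^sub>v)\<^sup>\<sigma>\<close> on the vertex set \<open>V\<close> for some choice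
  of the 1-factor. No 1-factor is mentioned when \<open>\<sigma> = 0\<close>, since none exists for odd \<open>v\<close>.\<close>

definition K_sigma :: "'a set \<Rightarrow> int \<Rightarrow> 'a set multiset \<Rightarrow> bool" where
  "K_sigma V \<sigma> E \<longleftrightarrow>
     \<sigma> = -1 \<and> (\<exists>I. one_factor V I \<and> E = mset_set (complete_edges V) - mset_set I) \<or>
     \<sigma> = 0 \<and> E = mset_set (complete_edges V) \<or>
     \<sigma> = 1 \<and> (\<exists>I. one_factor V I \<and> E = mset_set (complete_edges V) + mset_set I)"

text \<open>A spanning subgraph of a multigraph on \<open>V\<close> that is isomorphic to a simple graph is
  identified with its edge set.\<close>

definition factorization ::
    "'b graph \<Rightarrow> 'a set \<Rightarrow> 'a set multiset \<Rightarrow> 'a set set multiset \<Rightarrow> bool" where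
  "factorization F V E \<F> \<longleftrightarrow>
     (\<forall>G\<in>#\<F>. isomorphic F (V, G)) \<and> (\<Sum>G\<in>#\<F>. mset_set G) = E"

definition OP_solution :: "int \<Rightarrow> 'b graph \<Rightarrow> 'a set \<Rightarrow> 'a set set multiset \<Rightarrow> bool" where
  "OP_solution \<sigma> F V \<F> \<longleftrightarrow> (\<exists>E. K_sigma V \<sigma> E \<and> factorization F V E \<F>)"

text \<open>If \<open>F\<close> is 2-regular, the factors of a solution are pairwise distinct (a repeated factor
  would have all its edges doubled), so multiplicities play no role below.\<close>

definition automorphism :: "'a set \<Rightarrow> 'a set set multiset \<Rightarrow> ('a \<Rightarrow> 'a) \<Rightarrow> bool" where
  "automorphism V \<F> g \<longleftrightarrow> g \<in> Bij V \<and> (\<forall>G\<in>#\<F>. (\<lambda>e. g ` e) ` G \<in># \<F>)"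

definition pyramidal :: "nat \<Rightarrow> 'a set \<Rightarrow> 'a set set multiset \<Rightarrow> bool" where
  "pyramidal f V \<F> \<longleftrightarrow>
     (\<exists>H. subgroup H (BijGroup V) \<and> (\<forall>g\<in>H. automorphism V \<F> g) \<and>
       (let Fix = {x \<in> V. \<forall>g\<in>H. g x = x} in
          card Fix = f \<and> (\<forall>x\<in>V - Fix. \<forall>y\<in>V - Fix. \<exists>!g. g \<in> H \<and> g x = y)))"

definition has_pyramidal_solution :: "nat \<Rightarrow> int \<Rightarrow> 'b graph \<Rightarrow> bool" where
  "has_pyramidal_solution f \<sigma> F \<longleftrightarrow>
     (\<exists>\<F>. OP_solution \<sigma> F {..<card (verts F)} \<F> \<and> pyramidal f {..<card (verts F)} \<F>)"

end

(* The infinite vertices are fixed by the group Z_2n, and each factor is made invariant under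
   the involution x -> x + n.  Modulo that involution a factor becomes a path P and odd cycles of
   lengths l_i on Z_n: a cycle is covered either by two copies of itself or, if it closes up only
   after adding n, by one cycle of twice the length, and P is covered by the long cycle.  So one
   needs a partition of {0..<n} into a path and odd cycles whose edge differences are 1, ..., n - 1,
   each once (a graceful labelling).  Adding n along P after an edge of difference n - d exchanges
   the differences d and n - d, which allows any of the cycles to be twisted.

   Such labellings are built one cycle at a time, growing the order by a factor of about 5.  Around
   a labelling on {0..<N} the new odd cycle takes the differences N, ..., N + 2k - 1 and 2N + k.
   The new vertices not on this cycle form three pieces, each a low and a high block of integers,
   and a zigzag path in such a piece may start at any prescribed vertex.  This freedom is what
   allows the pieces to be linked by the missing differences N + 2k, 3N, 3N + 1. *)

theory Submission
  imports Defs
begin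

section \<open>Zigzag paths\<close>

fun steps :: "int list \<Rightarrow> int set" where
  "steps (x # y # xs) = insert \<bar>x - y\<bar> (steps (y # xs))"
| "steps xs = {}"

lemma steps_append:
  "xs \<noteq> [] \<Longrightarrow> ys \<noteq> [] \<Longrightarrow> steps (xs @ ys) = steps xs \<union> {\<bar>last xs - hd ys\<bar>} \<union> steps ys"
proof (induction xs rule: steps.induct)
  case ("2_2" v)
  then show ?case by (cases ys) auto
qed auto

lemma steps_rev: "steps (rev xs) = steps xs"
proof (induction xs rule: steps.induct)
  case (1 x y xs)
  then show ?case
    using steps_append[of "rev (y # xs)" "[x]"] by (auto simp: abs_minus_commute)
qed auto

lemma steps_map: "(\<And>x y. \<bar>f x - f y\<bar> = \<bar>x - y\<bar>) \<Longrightarrow> steps (map f xs) = steps xs"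
  by (induction xs rule: steps.induct) auto

lemma steps_less: "set xs \<subseteq> {a..<a + n} \<Longrightarrow> steps xs \<subseteq> {0..<n}"
  by (induction xs rule: steps.induct) auto

text \<open>The list has \<open>a + b\<close> entries, so each of its \<open>a + b - 1\<close>
  differences occurs exactly once: a graceful path whose differences are shifted by moving the low
  and the high block apart.\<close>

definition zigzag :: "int \<Rightarrow> int \<Rightarrow> int \<Rightarrow> int \<Rightarrow> int \<Rightarrow> int \<Rightarrow> int list \<Rightarrow> bool" where
  "zigzag lo hi a b x y xs \<longleftrightarrow> xs \<noteq> [] \<and> hd xs = x \<and> last xs = y \<and> int (length xs) = a + b \<and>
     set xs = {lo - a<..lo} \<union> {hi..<hi + b} \<and> steps xs = {hi - lo..<hi - lo + a + b - 1}"

lemma zigzag_rev: "zigzag lo hi a b x y xs \<Longrightarrow> zigzag lo hi a b y x (rev xs)"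
  by (auto simp: zigzag_def steps_rev hd_rev last_rev)

text \<open>Exchanges the two blocks, so that paths starting low also provide paths starting
  high.\<close>

lemma zigzag_reflect:
  assumes "zigzag lo hi a b x y xs"
  shows "zigzag (c - hi) (c - lo) b a (c - x) (c - y) (map (\<lambda>z. c - z) xs)"
proof -
  have "(\<lambda>z. c - z) ` ({lo - a<..lo} \<union> {hi..<hi + b})
      = {(c - hi) - b<..(c - hi)} \<union> {c - lo..<(c - lo) + a}" (is "?f ` ?A = ?B")
  proof
    show "?f ` ?A \<subseteq> ?B" by auto
    show "?B \<subseteq> ?f ` ?A"
    proof
      fix z assume "z \<in> ?B"
      then have "c - z \<in> ?A" by auto
      then show "z \<in> ?f ` ?A" by (metis diff_diff_eq2 add_diff_cancel_left' imageI)
    qed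
  qed
  then show ?thesis
    using assms
    by (auto simp: zigzag_def steps_map hd_map last_map algebra_simps)
qed

lemma zigzag_single: "zigzag lo hi 1 0 lo lo [lo]"
  by (auto simp: zigzag_def)

text \<open>The second path lives on the blocks directly outside those of the first, so its
  differences begin at \<open>hi - lo + a + b\<close>. One value is missing in between, and the
  joining edge supplies it.\<close>

lemma zigzag_join_out:
  assumes "zigzag lo hi a b x y xs" "zigzag (lo - a) (hi + b) a' b' x' y' ys"
    and "\<bar>y - x'\<bar> = hi - lo + a + b - 1" and "0 \<le> a" "0 \<le> b" "0 \<le> a'" "0 \<le> b'"
  shows "zigzag lo hi (a + a') (b + b') x y' (xs @ ys)"
proof -
  have "a + b \<ge> 1" "a' + b' \<ge> 1"
    using assms(1,2) by (auto simp: zigzag_def Suc_le_eq simp flip: length_greater_0_conv)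
  then show ?thesis
    using assms by (auto simp: zigzag_def steps_append)
qed

lemma zigzag_join_in:
  assumes "zigzag lo hi a b x y xs" "zigzag (lo - a) (hi + b) a' b' x' y' ys"
    and "\<bar>x - y'\<bar> = hi - lo + a + b - 1" and "0 \<le> a" "0 \<le> b" "0 \<le> a'" "0 \<le> b'"
  shows "zigzag lo hi (a + a') (b + b') x' y (ys @ xs)"
  using zigzag_rev[OF zigzag_join_out[OF zigzag_rev[OF assms(1)] zigzag_rev[OF assms(2)]]] assms(3-)
  by simp

text \<open>Induction on the block size: the blocks are cut into an inner and an outer part, each
  carrying a zigzag path. The position of \<open>t\<close> relative to half of \<open>a\<close>
  decides which part the path visits first.\<close>

lemma zigzag_even:
  assumes "lo < hi" "0 \<le> t" "t < a"
  shows "\<exists>xs. zigzag lo hi a a (lo - t) (hi + (a - 1 - t)) xs"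
  using assms
proof (induction "nat a" arbitrary: lo hi a t rule: less_induct)
  case less
  note IH = less.hyps and pr = less.prems
  consider "a = 1" | "2 * t + 2 \<le> a" | "a \<le> 2 * t" "t \<ge> 1" | "a = 2 * t + 1" "t \<ge> 1"
    using pr by linarith
  then show ?case
  proof cases
    case 1
    with pr have "zigzag lo hi a a (lo - t) (hi + (a - 1 - t)) [lo, hi]"
      by (auto simp: zigzag_def)
    then show ?thesis ..
  next
    case 2
    \<comment> \<open>The start is the lowest vertex of the inner part. The outer path begins at the
      same offset \<open>t\<close> in its own low block, which makes the joining difference
      \<open>hi - lo + 2 * t + 1\<close>.\<close>
    obtain xs where xs: "zigzag lo hi (t + 1) (t + 1) (lo - t) hi xs"
      using IH[of "t + 1" lo hi t] pr 2 by auto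
    obtain ys where ys: "zigzag (lo - (t + 1)) (hi + (t + 1)) (a - t - 1) (a - t - 1)
        (lo - (t + 1) - t) (hi + (t + 1) + (a - t - 1 - 1 - t)) ys"
      using IH[of "a - t - 1" "lo - (t + 1)" "hi + (t + 1)" t] pr 2 by auto
    show ?thesis
      using zigzag_join_out[OF xs ys] pr 2 by (auto simp: algebra_simps)
  next
    case 3
    \<comment> \<open>The start is now the top of the outer low block, so the outer path comes
      first. It ends in \<open>hi + (a - 1)\<close>, and the joining difference forces the offset
      \<open>2 * t - a\<close> of the inner path.\<close>
    obtain xs where xs: "zigzag lo hi t t (lo - (2 * t - a)) (hi + (t - 1 - (2 * t - a))) xs"
      using IH[of t lo hi "2 * t - a"] pr 3 by auto
    obtain ys where ys: "zigzag (lo - t) (hi + t) (a - t) (a - t) (lo - t) (hi + t + (a - t - 1)) ys"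
      using IH[of "a - t" "lo - t" "hi + t" 0] pr 3 by auto
    show ?thesis
      using zigzag_join_in[OF xs ys] pr 3 by (auto simp: algebra_simps)
  next
    case 4
    \<comment> \<open>Start and end are the middles of their blocks. The cut is unbalanced,
      \<open>t + 1\<close> low and \<open>t\<close> high vertices inside and the reverse outside;
      each middle vertex is attached to a balanced path of size \<open>t\<close>.\<close>
    obtain xs where xs: "zigzag lo hi t t lo (hi + (t - 1)) xs"
      using IH[of t lo hi 0] pr 4 by auto
    have 1: "zigzag lo hi (t + 1) (t + 0) (lo - t) lo ([lo - t] @ rev xs)"
      using zigzag_join_in[OF zigzag_rev[OF xs] zigzag_single[of "lo - t" "hi + t"]] pr 4
      by (auto simp: algebra_simps)
    obtain ys where ys: "zigzag (lo - (t + 1)) (hi + (t + 1)) t t (lo - (t + 1)) (hi + (t + 1) + (t - 1)) ys"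
      using IH[of t "lo - (t + 1)" "hi + (t + 1)" 0] pr 4 by auto
    have "zigzag (lo - (t + 1)) (hi + t) 0 1 (hi + t) (hi + t) [hi + t]"
      by (auto simp: zigzag_def)
    from zigzag_join_in[OF this, of t t "hi + (t + 1) + (t - 1)" "lo - (t + 1)" "rev ys"] zigzag_rev[OF ys]
    have 2: "zigzag (lo - (t + 1)) (hi + t) t (t + 1) (hi + 2 * t) (hi + t) (rev ys @ [hi + t])"
      using pr 4 by (auto simp: algebra_simps)
    show ?thesis
      using zigzag_join_out[OF 1, of t "t + 1" "hi + 2 * t" "hi + t" "rev ys @ [hi + t]"] 2 pr 4
      by (auto simp: algebra_simps)
  qed
qed

text \<open>The extra low vertex puts both ends into the low block, with offsets adding up to
  \<open>a\<close>; for \<open>2 * t = a\<close> they would coincide. If \<open>2 * t < a\<close>,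
  an unbalanced inner path ending in \<open>lo\<close> is followed by a reflected balanced outer
  path. Reversal gives the other half.\<close>

lemma zigzag_odd:
  assumes "lo < hi" "0 \<le> t" "t \<le> a" "2 * t \<noteq> a"
  shows "\<exists>xs. zigzag lo hi (a + 1) a (lo - t) (lo - (a - t)) xs"
proof -
  have *: "\<exists>xs. zigzag lo hi (a + 1) a (lo - t) (lo - (a - t)) xs" if t: "0 \<le> t" "2 * t < a" for t
  proof -
    have 1: "\<exists>xs. zigzag lo hi (t + 1) t (lo - t) lo xs"
    proof (cases "t = 0")
      case True
      then show ?thesis using zigzag_single[of lo hi] by auto
    next
      case False
      then obtain xs where xs: "zigzag lo hi t t lo (hi + (t - 1)) xs"
        using zigzag_even[of lo hi 0 t] assms t by auto
      then show ?thesis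
        using zigzag_join_in[OF zigzag_rev[OF xs] zigzag_single[of "lo - t" "hi + t"]] assms t
        by (auto simp: algebra_simps)
    qed
    then obtain xs where xs: "zigzag lo hi (t + 1) t (lo - t) lo xs" ..
    let ?c = "lo - (t + 1) + (hi + t)"
    obtain ys where "zigzag (lo - (t + 1)) (hi + t) (a - t) (a - t) (lo - (t + 1) - t) (hi + t + (a - t - 1 - t)) ys"
      using zigzag_even[of "lo - (t + 1)" "hi + t" t "a - t"] assms t by auto
    from zigzag_reflect[OF this, of ?c]
    have ys: "zigzag (lo - (t + 1)) (hi + t) (a - t) (a - t) (hi + 2 * t) (lo - (a - t)) (map (\<lambda>z. ?c - z) ys)"
      by (simp add: algebra_simps)
    show ?thesis
      using zigzag_join_out[OF xs ys] assms t by (auto simp: algebra_simps)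
  qed
  show ?thesis
  proof (cases "2 * t < a")
    case True
    then show ?thesis using * assms by auto
  next
    case False
    then obtain xs where "zigzag lo hi (a + 1) a (lo - (a - t)) (lo - (a - (a - t))) xs"
      using *[of "a - t"] assms by auto
    then show ?thesis using zigzag_rev by fastforce
  qed
qed


section \<open>Graceful labellings of a path together with cycles\<close>

abbreviation closing :: "int list \<Rightarrow> int" where
  "closing c \<equiv> \<bar>last c - hd c\<bar>"

text \<open>The last condition supplies, for each cycle, the path edge whose difference is exchanged with
  that of the closing edge when the cycle is twisted.\<close>

definition block :: "int \<Rightarrow> int \<Rightarrow> int list list \<Rightarrow> int list \<Rightarrow> bool" where
  "block a n cs P \<longleftrightarrow> P \<noteq> [] \<and> [] \<notin> set cs \<and> int (length (concat cs @ P)) = n \<and>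
     set (concat cs @ P) = {a..<a + n} \<and>
     {1..<n} \<subseteq> steps P \<union> (\<Union>c\<in>set cs. insert (closing c) (steps c)) \<and>
     (\<forall>c\<in>set cs. n - closing c \<in> steps P)"

lemma block_map:
  assumes "block a n cs P" and f: "\<And>x y. \<bar>f x - f y\<bar> = \<bar>x - y\<bar>" "f ` {a..<a + n} = {b..<b + n}"
  shows "block b n (map (map f) cs) (map f P)"
proof -
  have "set (concat (map (map f) cs) @ map f P) = f ` set (concat cs @ P)" by auto
  moreover have "closing (map f c) = closing c" if "c \<in> set cs" for c
  proof -
    have "c \<noteq> []" using assms that by (auto simp: block_def)
    then show ?thesis by (simp add: last_map hd_map f(1))
  qed
  moreover have "length (concat (map (map f) cs)) = length (concat cs)"
    by (simp add: length_concat comp_def)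
  ultimately show ?thesis
    using assms by (auto simp: block_def steps_map[OF f(1)])
qed

lemma block_shift:
  assumes "block a n cs P"
  shows "block (a + c) n (map (map (\<lambda>x. x + c)) cs) (map (\<lambda>x. x + c) P)"
  by (rule block_map[OF assms]) (auto simp: algebra_simps)

lemma block_reflect:
  assumes "block a n cs P"
  shows "block a n (map (map (\<lambda>x. 2 * a + n - 1 - x)) cs) (map (\<lambda>x. 2 * a + n - 1 - x) P)"
proof (rule block_map[OF assms])
  show "(\<lambda>x. 2 * a + n - 1 - x) ` {a..<a + n} = {a..<a + n}"
  proof (intro equalityI subsetI)
    fix x assume "x \<in> {a..<a + n}"
    then have "2 * a + n - 1 - x \<in> {a..<a + n}" "x = 2 * a + n - 1 - (2 * a + n - 1 - x)" by auto
    then show "x \<in> (\<lambda>x. 2 * a + n - 1 - x) ` {a..<a + n}" by blast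
  qed auto
qed auto

text \<open>Going outwards from the old interval, the blocks of \<open>xs\<close>,
  \<open>z1\<close>, \<open>z2\<close> have sizes \<open>k\<close>, \<open>m\<close>,
  \<open>m\<close> and reach down to \<open>- N\<close> and up to \<open>2 * N - 1\<close>. Then
  come the cycle vertex \<open>2 * N\<close> and the blocks of \<open>z3\<close>. From
  \<open>N\<close> on, the differences left over by the four zigzags are \<open>N\<close> and
  \<open>2 * N + k\<close>, used at the vertex \<open>2 * N\<close>, and the three values in
  \<open>j\<close>, used by the links.\<close>

lemma block_extend:
  assumes B: "block 0 N cs P" and k: "1 \<le> k" and N: "N = k + 2 * m" and m: "k < m"
    and c: "zigzag (-1) N k k (- k) N xs"
    and z1: "zigzag (- k - 1) (N + k) m m x1 y1 z1"
    and z2: "zigzag (- k - m - 1) (N + k + m) m m x2 y2 z2"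
    and z3: "zigzag (- N - 1) (2 * N + 1) A m3 x3 y3 z3"
    and A: "A = m3 \<or> A = m3 + 1" and m3: "0 < m3"
    and n: "n = 3 * N + 1 + A + m3" "4 * N < n"
    and j: "\<bar>last P - x1\<bar> = N + 2 * k" "\<bar>y1 - x3\<bar> = 3 * N" "\<bar>y3 - x2\<bar> = 3 * N + 1"
  shows "block (- N - A) n (cs @ [2 * N # xs]) (P @ z1 @ z3 @ z2)"
proof -
  have P: "P \<noteq> []" "[] \<notin> set cs" and z: "z1 \<noteq> []" "z2 \<noteq> []" "z3 \<noteq> []" "xs \<noteq> []"
    using assms by (auto simp: block_def zigzag_def)
  have st: "steps (P @ z1 @ z3 @ z2) = steps P \<union> {N + 2 * k} \<union> steps z1 \<union> {3 * N} \<union> steps z3 \<union> {3 * N + 1} \<union> steps z2"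
    using j P z z1 z2 z3 by (auto simp: steps_append zigzag_def)
  have sz: "steps xs = {N + 1..<N + 2 * k}" "steps z1 = {N + 2 * k + 1..<2 * N + k}"
     "steps z2 = {2 * N + k + 1..<3 * N}" "steps z3 = {3 * N + 2..<n}"
    using c z1 z2 z3 N n by (auto simp: zigzag_def)
  have cl: "closing (2 * N # xs) = N" "steps (2 * N # xs) = insert (2 * N + k) (steps xs)"
    using c N k m by (auto simp: zigzag_def neq_Nil_conv)
  have old: "0 < closing c" "closing c < N" if "c \<in> set cs" for c
  proof -
    have "steps P \<subseteq> {0..<N}" using B by (intro steps_less[of P 0]) (auto simp: block_def)
    moreover have "N - closing c \<in> steps P" using B that by (auto simp: block_def)
    ultimately show "0 < closing c" by auto
    have "set c \<subseteq> {0..<N}" "c \<noteq> []" using B that by (fastforce simp: block_def)+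
    then have "hd c \<in> {0..<N}" "last c \<in> {0..<N}" using hd_in_set last_in_set by blast+
    then show "closing c < N" by auto
  qed
  show ?thesis
    unfolding block_def
  proof (intro conjI ballI)
    show "int (length (concat (cs @ [2 * N # xs]) @ P @ z1 @ z3 @ z2)) = n"
      using B c z1 z2 z3 N n by (auto simp: block_def zigzag_def)
    have "set (concat (cs @ [2 * N # xs]) @ P @ z1 @ z3 @ z2)
        = {0..<N} \<union> set (2 * N # xs) \<union> set z1 \<union> set z2 \<union> set z3"
      using B by (auto simp: block_def)
    also have "\<dots> = {- N - A..<- N - A + n}"
      using c z1 z2 z3 N n A m3 k m by (auto simp: zigzag_def)
    finally show "set (concat (cs @ [2 * N # xs]) @ P @ z1 @ z3 @ z2) = {- N - A..<- N - A + n}" .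
    show "{1..<n} \<subseteq> steps (P @ z1 @ z3 @ z2) \<union> (\<Union>c\<in>set (cs @ [2 * N # xs]). insert (closing c) (steps c))"
    proof
      fix d assume d: "d \<in> {1..<n}"
      show "d \<in> steps (P @ z1 @ z3 @ z2) \<union> (\<Union>c\<in>set (cs @ [2 * N # xs]). insert (closing c) (steps c))"
      proof (cases "d < N")
        case True
        then have "d \<in> steps P \<union> (\<Union>c\<in>set cs. insert (closing c) (steps c))"
          using B d by (auto simp: block_def)
        then show ?thesis by (auto simp: st)
      next
        case False
        then have "d \<in> {N, 2 * N + k, N + 2 * k, 3 * N, 3 * N + 1} \<union> steps xs \<union> steps z1 \<union> steps z2 \<union> steps z3"
          using d unfolding sz by auto
        then show ?thesis using cl by (auto simp: st)
      qed
    qed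
    fix c assume "c \<in> set (cs @ [2 * N # xs])"
    then have "0 < closing c" "closing c \<le> N"
      using old[of c] cl(1) k N m by (auto simp del: last.simps list.sel)
    \<comment> \<open>Since \<open>4 * N < n\<close>, these values lie above \<open>3 * N\<close>,
      hence in the new part of the path. The old cycles remain twistable whatever their former
      partner edges were.\<close>
    then have "n - closing c \<in> insert (3 * N + 1) (steps z3)" using n(2) unfolding sz by auto
    then show "n - closing c \<in> steps (P @ z1 @ z3 @ z2)" by (auto simp: st)
  qed (use P in auto)
qed

text \<open>The number \<open>T\<close> locates the end of the path, where the next piece is
  attached. It becomes \<open>N + T + 1\<close>, so the step can be iterated.\<close>

lemma block_add_cycle:
  assumes B: "block 0 N cs P" "last P = N - 1 - T" and "0 \<le> T" "1 \<le> k"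
    and N: "even (N - k)" "2 * T + 3 * k + 2 \<le> N"
    and n: "4 * N + 2 * T + k + 3 \<le> n" "n \<le> 5 * N + 2 * T + 2"
  shows "\<exists>cs' P'. block 0 n cs' P' \<and> map length cs' = map length cs @ [nat (2 * k + 1)] \<and>
           last P' = n - 1 - (N + T + 1)"
proof -
  obtain m where m: "N = k + 2 * m" using N(1) by (metis evenE diff_add_cancel add.commute)
  \<comment> \<open>The offset at which \<open>z1\<close> must start for its link from
    \<open>N - 1 - T\<close> to have difference \<open>N + 2 * k\<close>.\<close>
  define i where "i = T + k"
  have i: "1 \<le> i" "i < m" using assms m by (auto simp: i_def)
  obtain xs where xs: "zigzag (-1) N k k (- k) N xs"
    using zigzag_even[of "-1" N "k - 1" k] assms by auto
  then have lenxs: "length (2 * N # xs) = nat (2 * k + 1)" using assms by (auto simp: zigzag_def)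
  obtain z1 where z1: "zigzag (- k - 1) (N + k) m m (- k - 1 - i) (N + k + (m - 1 - i)) z1"
    using zigzag_even[of "- k - 1" "N + k" i m] assms i by auto
  show ?thesis
  proof (cases "even (n - N)")
    case False
    define m3 where "m3 = (n - 3 * N - 1) div 2"
    then have m3: "n = 3 * N + 1 + m3 + m3" using False by presburger
    \<comment> \<open>The offset at which \<open>z2\<close> must start for its link from the end of
      \<open>z3\<close> to have difference \<open>3 * N + 1\<close>. Up to parity,
      \<open>0 \<le> u\<close> and \<open>u < m\<close> are the upper and lower bounds on
      \<open>n\<close> in the hypotheses.\<close>
    define u where "u = 2 * m + i - m3"
    have u: "0 \<le> u" "u < m" "m + i < m3" using n m m3 i by (auto simp: u_def i_def)
    obtain z2 where z2: "zigzag (- k - m - 1) (N + k + m) m m (- k - m - 1 - u) (N + k + m + (m - 1 - u)) z2"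
      using zigzag_even[of "- k - m - 1" "N + k + m" u m] assms i u by auto
    obtain z3 where z3: "zigzag (- N - 1) (2 * N + 1) m3 m3 (- N - 1 - (m + i)) (2 * N + 1 + (m3 - 1 - (m + i))) z3"
      using zigzag_even[of "- N - 1" "2 * N + 1" "m + i" m3] assms i u by auto
    have "block (- N - m3) n (cs @ [2 * N # xs]) (P @ z1 @ z3 @ z2)"
      by (rule block_extend[OF B(1) _ m _ xs z1 z2 z3])
        (use assms i u m m3 in \<open>auto simp: i_def u_def\<close>)
    from block_shift[OF this, of "N + m3"] have
      "block 0 n (map (map (\<lambda>x. x + (N + m3))) (cs @ [2 * N # xs])) (map (\<lambda>x. x + (N + m3)) (P @ z1 @ z3 @ z2))"
      by simp
    moreover have "last (map (\<lambda>x. x + (N + m3)) (P @ z1 @ z3 @ z2)) = n - 1 - (N + T + 1)"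
      using z2 m m3 by (auto simp: zigzag_def last_map u_def i_def)
    moreover have "map length (map (map (\<lambda>x. x + (N + m3))) (cs @ [2 * N # xs])) = map length cs @ [nat (2 * k + 1)]"
      using lenxs by (auto simp: comp_def)
    ultimately show ?thesis by blast
  next
    case True
    \<comment> \<open>In this parity \<open>z3\<close> has one more low vertex and ends low. So
      \<open>z2\<close> has to start high and ends low, and a final reflection brings the end of the
      path back to the prescribed form.\<close>
    define m3 where "m3 = (n - 3 * N - 2) div 2"
    then have m3: "n = 3 * N + 1 + (m3 + 1) + m3" using True by presburger
    define u where "u = 2 * m + i - m3"
    have u: "0 \<le> u" "u < m" "m + i < m3" using n m m3 i by (auto simp: u_def i_def)
    obtain zs where "zigzag (- k - m - 1) (N + k + m) m m (- k - m - 1 - u) (N + k + m + (m - 1 - u)) zs"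
      using zigzag_even[of "- k - m - 1" "N + k + m" u m] assms i u by auto
    then obtain z2 where
      z2: "zigzag (- k - m - 1) (N + k + m) m m (N + k + m + u) (- k - m - 1 - (m - 1 - u)) z2"
      using zigzag_reflect[of "- k - m - 1" "N + k + m" m m _ _ zs "N - 1"]
      by (smt (verit, best))
    \<comment> \<open>The two ends of \<open>z3\<close> differ because
      \<open>m3 \<le> 2 * m + i < 2 * (m + i)\<close>.\<close>
    obtain z3 where z3: "zigzag (- N - 1) (2 * N + 1) (m3 + 1) m3 (- N - 1 - (m + i)) (- N - 1 - (m3 - (m + i))) z3"
      using zigzag_odd[of "- N - 1" "2 * N + 1" "m + i" m3] assms i u by (auto simp: u_def)
    have "block (- N - (m3 + 1)) n (cs @ [2 * N # xs]) (P @ z1 @ z3 @ z2)"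
      by (rule block_extend[OF B(1) _ m _ xs z1 z2 z3])
        (use assms i u m m3 in \<open>auto simp: i_def u_def\<close>)
    from block_reflect[OF block_shift[OF this, of "N + m3 + 1"]] have
      "block 0 n (map (map (\<lambda>x. n - 1 - x)) (map (map (\<lambda>x. x + (N + m3 + 1))) (cs @ [2 * N # xs])))
         (map (\<lambda>x. n - 1 - x) (map (\<lambda>x. x + (N + m3 + 1)) (P @ z1 @ z3 @ z2)))" (is "block 0 n ?cs ?P")
      by simp
    moreover have "last ?P = n - 1 - (N + T + 1)"
      using z2 m m3 by (auto simp: zigzag_def last_map u_def i_def)
    moreover have "map length ?cs = map length cs @ [nat (2 * k + 1)]"
      using lenxs by (auto simp: comp_def)
    ultimately show ?thesis by blast
  qed
qed

text \<open>A zigzag on two adjacent blocks has differences starting at 1. For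
  \<open>N = 4 * T + 1\<close> its prescribed start and end would be the same vertex.\<close>

lemma block_path:
  assumes "0 \<le> T" "2 * T + 2 \<le> N" "N \<noteq> 4 * T + 1"
  shows "\<exists>P. block 0 N [] P \<and> last P = N - 1 - T"
proof (cases "even N")
  case True
  then obtain a where a: "N = 2 * a" by blast
  then obtain P where "zigzag (a - 1) a a a (a - 1 - T) (a + (a - 1 - T)) P"
    using zigzag_even[of "a - 1" a T a] assms by auto
  then have "block 0 N [] P \<and> last P = N - 1 - T"
    using assms a by (auto simp: zigzag_def block_def)
  then show ?thesis ..
next
  case False
  then obtain a where a: "N = 2 * a + 1" using oddE by blast
  then obtain P where P: "zigzag a (a + 1) (a + 1) a (a - T) T P"
    using zigzag_odd[of a "a + 1" T a] assms by auto
  then have "block 0 N [] P" using a assms by (auto simp: zigzag_def block_def)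
  from block_reflect[OF this] show ?thesis
    using P by (auto simp: zigzag_def last_map intro!: exI[of _ "map (\<lambda>x. N - 1 - x) P"])
qed

lemma block_one_cycle:
  assumes "0 \<le> T" "1 \<le> k" "N \<noteq> 4 * T + 1" "even (N - k)" "2 * T + 3 * k + 2 \<le> N"
    and "4 * N + 2 * T + k + 3 \<le> n" "n \<le> 5 * N + 2 * T + 2"
  shows "\<exists>cs P T. block 0 n cs P \<and> map length cs = [nat (2 * k + 1)] \<and>
           last P = n - 1 - T \<and> n \<le> 6 * T \<and> 10 * T \<le> 3 * n"
proof -
  obtain P where "block 0 N [] P" "last P = N - 1 - T"
    using block_path[of T N] assms by auto
  from block_add_cycle[OF this assms(1,2,4-7)] obtain cs' P' where
    "block 0 n cs' P'" "map length cs' = [nat (2 * k + 1)]" "last P' = n - 1 - (N + T + 1)"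
    by auto
  moreover have "n \<le> 6 * (N + T + 1)" using assms(1,2,5-) by simp
  moreover have "10 * (N + T + 1) \<le> 3 * n" using assms(1,2,5-) by simp
  ultimately show ?thesis by (intro exI[of _ cs'] exI[of _ P'] exI[of _ "N + T + 1"] conjI)
qed

text \<open>The extension step does not reach the orders 28 to 31 for a triangle, nor 43 and 44 for a
  pentagon; the labellings given for these were found by computer search.\<close>

lemma block_base:
  assumes "1 \<le> k" "14 * k + 10 \<le> n"
  shows "\<exists>cs P T. block 0 n cs P \<and> map length cs = [nat (2 * k + 1)] \<and>
           last P = n - 1 - T \<and> n \<le> 6 * T \<and> 10 * T \<le> 3 * n" (is "\<exists>cs P T. ?goal cs P T")
proof -
  \<comment> \<open>The largest \<open>d\<close> for which the order \<open>k + 2 * d\<close> with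
    \<open>T = 0\<close> meets the lower bound \<open>5 * k + 8 * d + 3 \<le> n\<close>. Rounding
    loses at most 7, so the upper bound \<open>5 * k + 10 * d + 2\<close> holds as well once
    \<open>4 \<le> d\<close>. Smaller \<open>d\<close> leave only triangles and pentagons.\<close>
  define d where "d = (n - 5 * k - 3) div 8"
  have d: "n - 5 * k - 3 = 8 * d + (n - 5 * k - 3) mod 8"
    "0 \<le> (n - 5 * k - 3) mod 8" "(n - 5 * k - 3) mod 8 < 8"
    by (auto simp: d_def)
  then have "k + 1 \<le> d" "n \<le> 5 * k + 8 * d + 10" using assms by linarith+
  moreover from this have "k = 1 \<or> k = 2" if "d < 4" using that assms by linarith
  ultimately consider "4 \<le> d" "k + 1 \<le> d" | "k = 1" "n \<in> {24..39}" | "k = 2" "n \<in> {38..44}"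
    using assms by fastforce
  then show ?thesis
  proof cases
    case 1
    moreover have "5 * k + 8 * d + 3 \<le> n" using d by linarith
    ultimately have "5 * k + 8 * d + 3 \<le> n" "n \<le> 5 * k + 10 * d + 2" "2 * k + 2 \<le> 2 * d" "k + 2 * d \<noteq> 1"
      using assms \<open>n \<le> 5 * k + 8 * d + 10\<close> by linarith+
    then show ?thesis
      using block_one_cycle[of 0 k "k + 2 * d" n] assms by simp
  next
    case 2
    then consider "n \<in> {24..27}" | "n \<in> {32..37}" | "n \<in> {34..39}" | "n = 28" | "n = 29" | "n = 30" | "n = 31"
      by force
    then show ?thesis
    proof cases
      case 1
      then show ?thesis using block_one_cycle[of 0 1 5 n] 2 by auto
    next
      case 2
      then show ?thesis using block_one_cycle[of 0 1 7 n] \<open>k = 1\<close> by auto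
    next
      case 3
      then show ?thesis using block_one_cycle[of 1 1 7 n] \<open>k = 1\<close> by auto
    next
      case 4
      have "block 0 28 [[13, 16, 14]] [12, 8, 20, 7, 18, 9, 19, 11, 17, 10, 15, 1, 26, 0, 27, 3, 24, 2, 25, 5, 23, 4, 21, 6, 22]"
        by code_simp
      then have "?goal [[13, 16, 14]] [12, 8, 20, 7, 18, 9, 19, 11, 17, 10, 15, 1, 26, 0, 27, 3, 24, 2, 25, 5, 23, 4, 21, 6, 22] 5"
        using 4 \<open>k = 1\<close> by simp
      then show ?thesis by (intro exI)
    next
      case 5
      have "block 0 29 [[12, 15, 14]] [17, 13, 8, 21, 7, 19, 9, 20, 11, 18, 10, 16, 1, 27, 0, 28, 3, 25, 2, 26, 5, 24, 4, 22, 6, 23]"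
        by code_simp
      then have "?goal [[12, 15, 14]] [17, 13, 8, 21, 7, 19, 9, 20, 11, 18, 10, 16, 1, 27, 0, 28, 3, 25, 2, 26, 5, 24, 4, 22, 6, 23] 5"
        using 5 \<open>k = 1\<close> by simp
      then show ?thesis by (intro exI)
    next
      case 6
      have "block 0 30 [[12, 18, 14]] [15, 16, 13, 8, 22, 7, 20, 9, 21, 11, 19, 10, 17, 1, 28, 0, 29, 3, 26, 2, 27, 5, 25, 4, 23, 6, 24]"
        by code_simp
      then have "?goal [[12, 18, 14]] [15, 16, 13, 8, 22, 7, 20, 9, 21, 11, 19, 10, 17, 1, 28, 0, 29, 3, 26, 2, 27, 5, 25, 4, 23, 6, 24] 5"
        using 6 \<open>k = 1\<close> by simp
      then show ?thesis by (intro exI)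
    next
      case 7
      have "block 0 31 [[13, 16, 15]] [9, 20, 10, 19, 11, 23, 6, 25, 7, 22, 8, 21, 14, 18, 12, 17, 1, 29, 0, 30, 3, 27, 2, 28, 5, 26, 4, 24]"
        by code_simp
      then have "?goal [[13, 16, 15]] [9, 20, 10, 19, 11, 23, 6, 25, 7, 22, 8, 21, 14, 18, 12, 17, 1, 29, 0, 30, 3, 27, 2, 28, 5, 26, 4, 24] 6"
        using 7 \<open>k = 1\<close> by simp
      then show ?thesis by (intro exI)
    qed
  next
    case 3
    then consider "n \<in> {38..42}" | "n = 43" | "n = 44" by force
    then show ?thesis
    proof cases
      case 1
      then show ?thesis using block_one_cycle[of 0 2 8 n] 3 by auto
    next
      case 2
      have "block 0 43 [[18, 25, 21, 19, 24]] [17, 26, 16, 27, 15, 28, 14, 29, 13, 30, 8, 32, 11, 31, 12, 20, 23, 22, 4, 40, 10, 33, 6, 37, 5, 38, 3, 42, 0, 41, 1, 39, 2, 36, 7, 35, 9, 34]"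
        by code_simp
      then have "?goal [[18, 25, 21, 19, 24]] [17, 26, 16, 27, 15, 28, 14, 29, 13, 30, 8, 32, 11, 31, 12, 20, 23, 22, 4, 40, 10, 33, 6, 37, 5, 38, 3, 42, 0, 41, 1, 39, 2, 36, 7, 35, 9, 34] 8"
        using 2 \<open>k = 2\<close> by simp
      then show ?thesis by (intro exI)
    next
      case 3
      have "block 0 44 [[18, 24, 22, 26, 19]] [21, 12, 32, 11, 33, 8, 31, 13, 30, 14, 29, 15, 28, 16, 27, 17, 25, 20, 23, 4, 41, 10, 34, 6, 38, 5, 39, 3, 43, 0, 42, 1, 40, 2, 37, 7, 36, 9, 35]"
        by code_simp
      then have "?goal [[18, 24, 22, 26, 19]] [21, 12, 32, 11, 33, 8, 31, 13, 30, 14, 29, 15, 28, 16, 27, 17, 25, 20, 23, 4, 41, 10, 34, 6, 38, 5, 39, 3, 43, 0, 42, 1, 40, 2, 37, 7, 36, 9, 35] 8"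
        using 3 \<open>k = 2\<close> by simp
      then show ?thesis by (intro exI)
    qed
  qed
qed

text \<open>The bounds on \<open>T\<close> make the ranges of orders reached from labellings of different orders overlap.\<close>

lemma blocks_exist:
  assumes "ls \<noteq> []" and "\<forall>x\<in>set ls. odd x \<and> 3 \<le> x \<and> x \<le> L"
    and "7 ^ (length ls - 1) * (6 * int L + 3) + int L \<le> n"
  shows "\<exists>cs P T. block 0 n cs P \<and> map length cs = ls \<and> last P = n - 1 - T \<and> n \<le> 6 * T \<and> 10 * T \<le> 3 * n"
  using assms
proof (induction ls arbitrary: n rule: rev_nonempty_induct)
  case (single x)
  have "odd x" using single by simp
  then obtain k where k: "x = 2 * k + 1" by (rule oddE)
  \<comment> \<open>For \<open>n\<close> at least \<open>7 * L + 3\<close> and \<open>L\<close> at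
    least \<open>2 * k + 1\<close>, this is the threshold of \<open>block_base\<close>.\<close>
  then have "14 * int k + 10 \<le> n" "1 \<le> int k" using single by auto
  from block_base[OF this(2,1)] show ?case using k by (simp add: nat_add_distrib nat_mult_distrib)
next
  case (snoc x ls)
  have "odd x" using snoc.prems by simp
  then obtain k where k: "x = 2 * k + 1" by (rule oddE)
  then have kL: "1 \<le> int k" "2 * int k + 1 \<le> int L" using snoc.prems by auto
  define X where "X = 7 ^ (length ls - 1) * (6 * int L + 3)"
  have X: "6 * int L + 3 \<le> X" unfolding X_def by (simp add: mult_le_cancel_right1)
  have "7 ^ length ls = 7 * (7::int) ^ (length ls - 1)" using snoc.hyps by (cases ls) auto
  then have n: "7 * X + int L \<le> n" using snoc.prems by (simp add: X_def)
  \<comment> \<open>With \<open>T\<close> at most \<open>3 * N / 10\<close>, the condition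
    \<open>4 * N + 2 * T + k + 3 \<le> n\<close> follows from
    \<open>23 * N \<le> 5 * (n - k - 3)\<close>. Here \<open>N\<close> is the largest such integer
    of the parity of \<open>k\<close>. The growth factor stays below 7, which explains the powers of
    7 in the bound.\<close>
  define e where "e = (5 * (n - int k - 3) - 23 * int k) div 46"
  define N where "N = int k + 2 * e"
  have "5 * (n - int k - 3) - 23 * int k = 46 * e + (5 * (n - int k - 3) - 23 * int k) mod 46"
    "0 \<le> (5 * (n - int k - 3) - 23 * int k) mod 46" "(5 * (n - int k - 3) - 23 * int k) mod 46 < 46"
    by (auto simp: e_def)
  then have N: "23 * N \<le> 5 * n - 5 * int k - 15" "5 * n - 5 * int k - 15 < 23 * N + 46"
    by (auto simp: N_def)
  have "X + int L \<le> N" using N n X kL by linarith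
  then obtain cs P T where B: "block 0 N cs P" "map length cs = ls" "last P = N - 1 - T" "N \<le> 6 * T" "10 * T \<le> 3 * N"
    using snoc.IH[of N] snoc.prems by (auto simp: X_def)
  have "even (N - int k)" by (simp add: N_def)
  moreover have "2 * T + 3 * int k + 2 \<le> N" "4 * N + 2 * T + int k + 3 \<le> n" "n \<le> 5 * N + 2 * T + 2"
    using B(4,5) N n X kL \<open>X + int L \<le> N\<close> by linarith+
  ultimately obtain cs' P' where "block 0 n cs' P'" "map length cs' = map length cs @ [nat (2 * int k + 1)]"
      "last P' = n - 1 - (N + T + 1)"
    using block_add_cycle[OF B(1,3), of "int k" n] B(4,5) kL by auto
  moreover have "n \<le> 6 * (N + T + 1)" "10 * (N + T + 1) \<le> 3 * n"
    using B(4,5) \<open>4 * N + 2 * T + int k + 3 \<le> n\<close> \<open>n \<le> 5 * N + 2 * T + 2\<close> kL by simp_all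
  moreover have "map length cs @ [nat (2 * int k + 1)] = ls @ [x]"
    using B(2) k by (simp add: nat_add_distrib nat_mult_distrib)
  ultimately show ?case by metis
qed

section \<open>From starters to pyramidal solutions\<close>

text \<open>The distance of two residues on a circle of \<open>2 * n\<close> points, which
  classifies the orbits of edges under rotation.\<close>

definition gap :: "nat \<Rightarrow> int \<times> int \<Rightarrow> int" where
  "gap n p = min ((fst p - snd p) mod (2 * int n)) (2 * int n - (fst p - snd p) mod (2 * int n))"

lemma gap_eq_iff:
  assumes "0 < n"
  shows "gap n (a, b) = gap n (x, y) \<longleftrightarrow>
     2 * int n dvd (a - b) - (x - y) \<or> 2 * int n dvd (b - a) - (x - y)"
proof -
  define m u w where "m = 2 * int n" and "u = a - b" and "w = x - y"
  have m: "0 < m" using assms by (simp add: m_def)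
  have *: "m dvd - u - w \<longleftrightarrow> u mod m = (- w) mod m"
  proof -
    have "- u - w = - (u + w)" by simp
    then show ?thesis by (simp only: dvd_minus_iff mod_eq_dvd_iff diff_minus_eq_add)
  qed
  have "min (u mod m) (m - u mod m) = min (w mod m) (m - w mod m) \<longleftrightarrow>
      u mod m = w mod m \<or> u mod m = (- w) mod m"
  proof -
    obtain r r' where r: "u mod m = r" "w mod m = r'" "0 \<le> r" "r < m" "0 \<le> r'" "r' < m"
      using m by simp
    then have "(- w) mod m = (if r' = 0 then 0 else m - r')" by (auto simp: zmod_zminus1_eq_if)
    then show ?thesis using r by (auto simp: min_def)
  qed
  then show ?thesis
    unfolding gap_def using * by (simp add: m_def u_def w_def mod_eq_dvd_iff algebra_simps)
qed

definition vtx :: "nat \<Rightarrow> int \<Rightarrow> nat" where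
  "vtx n z = nat (z mod (2 * int n))"

lemma vtx_eq_iff: "0 < n \<Longrightarrow> vtx n z = vtx n w \<longleftrightarrow> 2 * int n dvd z - w"
  by (simp add: vtx_def mod_eq_dvd_iff nat_eq_iff)

lemma vtx_less: "0 < n \<Longrightarrow> vtx n z < 2 * n"
  by (simp add: vtx_def nat_less_iff)

lemma vtx_of_nat: "a < 2 * n \<Longrightarrow> vtx n (int a) = a"
  by (simp add: vtx_def)

definition edge_pair :: "nat \<Rightarrow> int \<times> int \<Rightarrow> nat set set" where
  "edge_pair n p = {{vtx n (fst p), vtx n (snd p)}, {vtx n (fst p + int n), vtx n (snd p + int n)}}"

text \<open>Once the difference is fixed modulo \<open>2 * n\<close>, one end determines the edge.
  As the two edges of a pair differ by the shift by \<open>n\<close>, only the residue of that end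
  modulo \<open>n\<close> matters.\<close>

lemma mem_edge_pair_iff:
  assumes "0 < n"
  shows "{vtx n a, vtx n b} \<in> edge_pair n (x, y) \<longleftrightarrow>
     int n dvd a - x \<and> 2 * int n dvd (a - b) - (x - y) \<or>
     int n dvd b - x \<and> 2 * int n dvd (b - a) - (x - y)"
proof -
  have *: "2 * int n dvd a - x \<and> 2 * int n dvd b - y \<or> 2 * int n dvd a - (x + int n) \<and> 2 * int n dvd b - (y + int n) \<longleftrightarrow>
      int n dvd a - x \<and> 2 * int n dvd (a - b) - (x - y)" (is "?l \<longleftrightarrow> ?r") for a b
  proof
    assume ?l
    then show ?r
    proof
      assume *: "2 * int n dvd a - x \<and> 2 * int n dvd b - y"
      then have "2 * int n dvd (a - x) - (b - y)" using dvd_diff by blast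
      with * show ?r by (auto simp: algebra_simps dest: dvd_mult_right)
    next
      assume *: "2 * int n dvd a - (x + int n) \<and> 2 * int n dvd b - (y + int n)"
      then have "2 * int n dvd (a - (x + int n)) - (b - (y + int n))" using dvd_diff by blast
      moreover have "int n dvd (a - (x + int n)) + int n" using * by (meson dvd_add dvd_mult_right dvd_refl)
      ultimately show ?r by (auto simp: algebra_simps)
    qed
  next
    assume r: ?r
    then obtain q where q: "a - x = int n * q" by auto
    have y: "b - y = (a - x) - ((a - b) - (x - y))" "b - (y + int n) = (a - (x + int n)) - ((a - b) - (x - y))" by simp_all
    show ?l
    proof (cases "even q")
      case True
      then have "2 * int n dvd a - x" using q by (auto simp: mult.commute)
      then show ?thesis using r dvd_diff y(1) by metis
    next
      case False
      then obtain q' where "q = 2 * q' + 1" by (rule oddE)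
      then have "a - (x + int n) = 2 * int n * q'" using q by (simp add: algebra_simps)
      then have "2 * int n dvd a - (x + int n)" by simp
      then show ?thesis using r dvd_diff y(2) by metis
    qed
  qed
  show ?thesis
    unfolding edge_pair_def
    using *[of a b] *[of b a] assms by (auto simp: doubleton_eq_iff vtx_eq_iff)
qed

lemma vtx_add_period: "0 < n \<Longrightarrow> vtx n (z + int n + int n) = vtx n z"
  by (simp add: vtx_eq_iff)

lemma edge_pair_add:
  assumes "0 < n"
  shows "edge_pair n (x + (t + int n), y + (t + int n)) = edge_pair n (x + t, y + t)"
  unfolding edge_pair_def fst_conv snd_conv add.assoc[symmetric] vtx_add_period[OF assms]
  by (rule insert_commute)

lemma edge_cases:
  assumes "e \<in> complete_edges {..<2 * n + f}" "0 < n"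
  obtains (inner) a b where "e = {vtx n a, vtx n b}" "\<not> 2 * int n dvd a - b"
  | (mixed) i b where "i < f" "e = {2 * n + i, vtx n b}"
  | (outer) i j where "i < j" "j < f" "e = {2 * n + i, 2 * n + j}"
proof -
  obtain x y where xy: "e = {x, y}" "x < y" "y < 2 * n + f"
    using assms(1) unfolding complete_edges_def card_2_iff
    by (smt (verit) insert_commute insert_subset lessThan_iff linorder_neqE_nat mem_Collect_eq)
  consider "y < 2 * n" | "x < 2 * n" "2 * n \<le> y" | "2 * n \<le> x" by linarith
  then show thesis
  proof cases
    case 1
    then show ?thesis using inner[of "int x" "int y"] xy assms(2) vtx_eq_iff[of n "int x" "int y"]
      by (simp add: vtx_of_nat)
  next
    case 2
    then show ?thesis using mixed[of "y - 2 * n" "int x"] xy by (auto simp: vtx_of_nat insert_commute)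
  next
    case 3
    then show ?thesis using outer[of "x - 2 * n" "y - 2 * n"] xy by auto
  qed
qed

text \<open>The vertices below \<open>2 * n\<close> are the residues modulo \<open>2 * n\<close>, those from \<open>2 * n\<close> on are fixed by
  the group. \<open>H\<close> contains one of the two edges of each difference in the base factor, \<open>S\<close> gives its
  edges of difference \<open>n\<close>, and \<open>ys ! i\<close> and \<open>ys ! i + n\<close> are the neighbours of \<open>2 * n + i\<close>.\<close>

locale starter =
  fixes n :: nat and H :: "(int \<times> int) set" and S :: "int set" and ys :: "int list"
  assumes n: "2 \<le> n"
    and gap_inj: "inj_on (gap n) H" and gap_image: "gap n ` H = {1..<int n}"
    and S_inj: "inj_on (\<lambda>x. x mod int n) S" and S_finite: "finite S"
    and S_card: "card S + length ys = 2"
begin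

abbreviation V where "V \<equiv> {..<2 * n + length ys}"

definition factor :: "int \<Rightarrow> nat set set" where
  "factor t = (\<Union>(x, y)\<in>H \<union> (\<lambda>x. (x, x + int n)) ` S. edge_pair n (x + t, y + t)) \<union>
     (\<Union>i<length ys. {{2 * n + i, vtx n (ys ! i + t)}, {2 * n + i, vtx n (ys ! i + t + int n)}})"

text \<open>For \<open>length ys\<close> equal to 0 or 2 this is the 1-factor to be doubled or
  removed. With two fixed vertices, the edge between them must belong to it.\<close>

definition antipodal :: "nat set set" where
  "antipodal = {{x, x + n} | x. x < n} \<union> (if length ys = 2 then {{2 * n, 2 * n + 1}} else {})"

lemma n0: "0 < n" using n by simp

lemma vtx_ne: "vtx n z \<noteq> 2 * n + i"
  using vtx_less[OF n0, of z] by linarith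

text \<open>The base factor is invariant under the half turn, so its orbit is given by the
  translates by \<open>0, ..., n - 1\<close>, although the group has order
  \<open>2 * n\<close>.\<close>

lemma factor_periodic: "factor (t + int n) = factor t"
proof -
  have "{{2 * n + i, vtx n (ys ! i + (t + int n))}, {2 * n + i, vtx n (ys ! i + (t + int n) + int n)}}
     = {{2 * n + i, vtx n (ys ! i + t)}, {2 * n + i, vtx n (ys ! i + t + int n)}}" for i
    unfolding add.assoc[symmetric] vtx_add_period[OF n0] by (rule insert_commute)
  then show ?thesis by (simp add: factor_def edge_pair_add[OF n0])
qed

lemma factor_mod: "factor (t mod int n) = factor t"
proof -
  have "factor (s + int k * int n) = factor s" for s k
  proof (induction k)
    case (Suc k)
    then show ?case using factor_periodic[of "s + int k * int n"] by (simp add: algebra_simps)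
  qed simp
  then have *: "factor (s + q * int n) = factor s" if "0 \<le> q" for s q
    using that by (metis nonneg_int_cases)
  define q r where "q = t div int n" and "r = t mod int n"
  have t: "t = r + q * int n" by (simp add: q_def r_def)
  have "factor (r + q * int n) = factor r"
  proof (cases "0 \<le> q")
    case False
    then have "factor (r + q * int n + (- q) * int n) = factor (r + q * int n)" by (intro *) simp
    then show ?thesis by simp
  qed (rule *)
  then have "factor t = factor r" using t by simp
  then show ?thesis by (simp add: r_def)
qed

lemma inner_mem_factor:
  "{vtx n a, vtx n b} \<in> factor t \<longleftrightarrow>
     (\<exists>(x, y)\<in>H \<union> (\<lambda>x. (x, x + int n)) ` S.
        int n dvd a - x - t \<and> 2 * int n dvd (a - b) - (x - y) \<or>
        int n dvd b - x - t \<and> 2 * int n dvd (b - a) - (x - y))"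
proof -
  have "{vtx n a, vtx n b} \<noteq> {2 * n + i, vtx n z}" for i z
    using vtx_ne by (metis doubleton_eq_iff)
  then have "{vtx n a, vtx n b} \<in> factor t \<longleftrightarrow>
     (\<exists>(x, y)\<in>H \<union> (\<lambda>x. (x, x + int n)) ` S. {vtx n a, vtx n b} \<in> edge_pair n (x + t, y + t))"
    unfolding factor_def by blast
  then show ?thesis
    unfolding mem_edge_pair_iff[OF n0] add_diff_cancel_right unfolding diff_diff_eq[symmetric] .
qed

lemma residue_iff: "t < n \<and> int n dvd c - int t \<longleftrightarrow> t = nat (c mod int n)"
proof
  assume t: "t < n \<and> int n dvd c - int t"
  then have "c mod int n = int t" by (metis mod_eq_dvd_iff mod_pos_pos_trivial of_nat_0_le_iff of_nat_less_iff)
  then show "t = nat (c mod int n)" by simp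
next
  assume t: "t = nat (c mod int n)"
  then have "int t = c mod int n" using n0 by simp
  then show "t < n \<and> int n dvd c - int t"
    using n0 by (metis dvd_minus_mod of_nat_0_less_iff of_nat_less_iff pos_mod_bound)
qed

text \<open>The length of the edge singles out one pair of \<open>H\<close>, its difference then
  fixes the orientation, and the orientation fixes the translation modulo \<open>n\<close>.\<close>

lemma card_inner:
  assumes "\<not> 2 * int n dvd a - b" "\<not> 2 * int n dvd a - b - int n"
  shows "card {t. t < n \<and> {vtx n a, vtx n b} \<in> factor (int t)} = 1"
proof -
  have nd: "\<not> 2 * int n dvd (a - b) - (x - (x + int n))" "\<not> 2 * int n dvd (b - a) - (x - (x + int n))" for x
  proof -
    have "(a - b) - (x - (x + int n)) = (a - b - int n) + 2 * int n" by simp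
    then show "\<not> 2 * int n dvd (a - b) - (x - (x + int n))" using assms(2) by (metis dvd_add_left_iff dvd_refl)
    have "(b - a) - (x - (x + int n)) = - (a - b - int n)" by simp
    then show "\<not> 2 * int n dvd (b - a) - (x - (x + int n))" using assms(2) by (metis dvd_minus_iff)
  qed
  have "gap n (a, b) \<in> {1..<int n}"
  proof -
    define r where "r = (a - b) mod (2 * int n)"
    have "0 \<le> r" "r < 2 * int n" "r \<noteq> 0" using assms(1) n0 by (auto simp: r_def dvd_eq_mod_eq_0)
    moreover have "r \<noteq> int n"
    proof
      assume "r = int n"
      then have "(a - b) mod (2 * int n) = int n mod (2 * int n)" using n0 by (simp add: r_def)
      then show False using assms(2) unfolding mod_eq_dvd_iff by blast
    qed
    ultimately show ?thesis by (auto simp: gap_def r_def[symmetric])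
  qed
  then obtain x y where xy: "(x, y) \<in> H" "gap n (a, b) = gap n (x, y)"
    unfolding gap_image[symmetric] by auto
  have mem: "{vtx n a, vtx n b} \<in> factor t \<longleftrightarrow>
        int n dvd a - x - t \<and> 2 * int n dvd (a - b) - (x - y) \<or>
        int n dvd b - x - t \<and> 2 * int n dvd (b - a) - (x - y)" (is "?l \<longleftrightarrow> ?r") for t
  proof
    assume ?r
    then show ?l using xy(1) unfolding inner_mem_factor by blast
  next
    assume ?l
    then obtain x' y' where *: "(x', y') \<in> H \<union> (\<lambda>x. (x, x + int n)) ` S"
      "int n dvd a - x' - t \<and> 2 * int n dvd (a - b) - (x' - y') \<or>
        int n dvd b - x' - t \<and> 2 * int n dvd (b - a) - (x' - y')"
      unfolding inner_mem_factor by blast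
    then have "(x', y') \<in> H" using nd by auto
    moreover have "gap n (a, b) = gap n (x', y')" using * by (auto simp: gap_eq_iff[OF n0])
    ultimately have "(x', y') = (x, y)" by (metis gap_inj inj_onD xy)
    then show ?r using * by simp
  qed
  \<comment> \<open>If both orientations matched, \<open>2 * (a - b)\<close> would vanish modulo
    \<open>2 * n\<close>, so \<open>a - b\<close> would be 0 or \<open>n\<close> there, which the
    assumptions exclude.\<close>
  have xor: "\<not> (2 * int n dvd (a - b) - (x - y) \<and> 2 * int n dvd (b - a) - (x - y))"
  proof
    assume "2 * int n dvd (a - b) - (x - y) \<and> 2 * int n dvd (b - a) - (x - y)"
    then have "2 * int n dvd ((a - b) - (x - y)) - ((b - a) - (x - y))" using dvd_diff by blast
    then have "2 * int n dvd 2 * (a - b)" by (simp add: algebra_simps)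
    then have "int n dvd a - b" by (metis dvd_times_left_cancel_iff zero_neq_numeral)
    then obtain q where q: "a - b = int n * q" by auto
    show False
    proof (cases "even q")
      case True
      then show False using assms(1) q by (auto simp: mult.commute)
    next
      case False
      then obtain q' where "q = 2 * q' + 1" by (rule oddE)
      then have "a - b - int n = 2 * int n * q'" using q by (simp add: algebra_simps)
      then show False using assms(2) by simp
    qed
  qed
  define c where "c = (if 2 * int n dvd (a - b) - (x - y) then a else b)"
  have "2 * int n dvd (a - b) - (x - y) \<or> 2 * int n dvd (b - a) - (x - y)"
    using xy(2) by (simp only: gap_eq_iff[OF n0])
  with xor have "{vtx n a, vtx n b} \<in> factor t \<longleftrightarrow> int n dvd c - x - t" for t
    unfolding mem c_def by argo
  then have "{t. t < n \<and> {vtx n a, vtx n b} \<in> factor (int t)} = {nat ((c - x) mod int n)}"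
    by (simp add: residue_iff)
  then show ?thesis by simp
qed

text \<open>An edge of difference \<open>n\<close> fits each element of \<open>S\<close> in both
  orientations, with the same translation modulo \<open>n\<close>. Distinct elements of
  \<open>S\<close> give distinct translations.\<close>

lemma card_antipodal:
  assumes "2 * int n dvd a - b - int n"
  shows "card {t. t < n \<and> {vtx n a, vtx n b} \<in> factor (int t)} = card S"
proof -
  have ab: "2 * int n dvd (a - b) - (x - (x + int n))" "2 * int n dvd (b - a) - (x - (x + int n))" for x
  proof -
    have "(a - b) - (x - (x + int n)) = (a - b - int n) + 2 * int n" by simp
    then show "2 * int n dvd (a - b) - (x - (x + int n))" using assms by (metis dvd_add_left_iff dvd_refl)
    have "(b - a) - (x - (x + int n)) = - (a - b - int n)" by simp
    then show "2 * int n dvd (b - a) - (x - (x + int n))" using assms by (metis dvd_minus_iff)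
  qed
  have notH: False if "(x, y) \<in> H" "2 * int n dvd (a - b) - (x - y) \<or> 2 * int n dvd (b - a) - (x - y)" for x y
  proof -
    have "gap n (a, b) = gap n (x, y)" using that by (simp add: gap_eq_iff[OF n0])
    then have "gap n (a, b) \<in> {1..<int n}" using that(1) unfolding gap_image[symmetric] by auto
    moreover have "(a - b) mod (2 * int n) = int n mod (2 * int n)" using assms unfolding mod_eq_dvd_iff .
    then have "gap n (a, b) = int n" using n0 by (simp add: gap_def)
    ultimately show False by simp
  qed
  have bx: "int n dvd b - x - t \<longleftrightarrow> int n dvd a - x - t" for x t
  proof -
    have "int n dvd a - b - int n" using assms by (rule dvd_mult_right)
    then have "int n dvd (a - b - int n) + int n" by (metis dvd_add dvd_refl)
    moreover have "a - x - t = (b - x - t) + ((a - b - int n) + int n)" by simp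
    ultimately show ?thesis by (metis dvd_add_left_iff)
  qed
  have "{vtx n a, vtx n b} \<in> factor t \<longleftrightarrow> (\<exists>x\<in>S. int n dvd a - x - t)" for t
    unfolding inner_mem_factor using ab bx notH by blast
  then have "{t. t < n \<and> {vtx n a, vtx n b} \<in> factor (int t)} = (\<lambda>x. nat ((a - x) mod int n)) ` S"
    by (simp add: image_def residue_iff flip: bex_simps)
  moreover have "inj_on (\<lambda>x. nat ((a - x) mod int n)) S"
  proof (rule inj_onI)
    fix x y assume xy: "x \<in> S" "y \<in> S" "nat ((a - x) mod int n) = nat ((a - y) mod int n)"
    then have "(a - x) mod int n = (a - y) mod int n" using n0 by (simp add: nat_eq_iff)
    then have "int n dvd y - x" by (simp add: mod_eq_dvd_iff)
    then have "y mod int n = x mod int n" by (simp add: mod_eq_dvd_iff)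
    then show "x = y" using S_inj xy by (simp add: inj_on_def)
  qed
  ultimately show ?thesis by (simp add: card_image)
qed

text \<open>The neighbours of a fixed vertex in a translate form one residue class modulo
  \<open>n\<close>, and the classes of the \<open>n\<close> translates are all different.\<close>

lemma card_mixed:
  assumes "i < length ys"
  shows "card {t. t < n \<and> {2 * n + i, vtx n b} \<in> factor (int t)} = 1"
proof -
  have "{2 * n + i, vtx n b} \<notin> edge_pair n p" for p
    using vtx_ne by (auto simp: edge_pair_def doubleton_eq_iff) metis+
  then have "{2 * n + i, vtx n b} \<in> factor t \<longleftrightarrow>
      2 * int n dvd b - (ys ! i + t) \<or> 2 * int n dvd b - (ys ! i + t + int n)" for t
    using assms vtx_ne unfolding factor_def
    by (auto simp: doubleton_eq_iff vtx_eq_iff[OF n0])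
  moreover have "2 * int n dvd z \<or> 2 * int n dvd z - int n \<longleftrightarrow> int n dvd z" for z
  proof
    assume "int n dvd z"
    then obtain q where q: "z = int n * q" by auto
    show "2 * int n dvd z \<or> 2 * int n dvd z - int n"
    proof (cases "even q")
      case False
      then obtain q' where "q = 2 * q' + 1" by (rule oddE)
      then have "z - int n = 2 * int n * q'" using q by (simp add: algebra_simps)
      then show ?thesis by simp
    qed (auto simp: q)
  qed (metis dvd_add diff_add_cancel dvd_mult_right dvd_refl)
  from this[of "b - ys ! i - t" for t] have
    "2 * int n dvd b - (ys ! i + t) \<or> 2 * int n dvd b - (ys ! i + t + int n) \<longleftrightarrow> int n dvd b - ys ! i - t" for t
    by (simp add: algebra_simps)
  ultimately have "{t. t < n \<and> {2 * n + i, vtx n b} \<in> factor (int t)} = {nat ((b - ys ! i) mod int n)}"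
    by (simp add: residue_iff)
  then show ?thesis by simp
qed

lemma card_outer:
  assumes "i < j"
  shows "card {t. t < n \<and> {2 * n + i, 2 * n + j} \<in> factor (int t)} = 0"
proof -
  have "{2 * n + i, 2 * n + j} \<notin> factor t" for t
    using vtx_ne assms by (auto simp: factor_def edge_pair_def doubleton_eq_iff) metis+
  then show ?thesis by simp
qed

lemma doubleton_complete_edges: "{x, y} \<in> complete_edges A \<longleftrightarrow> x \<in> A \<and> y \<in> A \<and> x \<noteq> y"
  by (auto simp: complete_edges_def card_insert_if)

lemma factor_subset: "factor t \<subseteq> complete_edges V"
proof -
  have *: "edge_pair n (x, y) \<subseteq> complete_edges V" if "\<not> 2 * int n dvd x - y" for x y
    using that vtx_less[OF n0] by (auto simp: edge_pair_def doubleton_complete_edges vtx_eq_iff[OF n0] trans_less_add1)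
  have "\<not> 2 * int n dvd x - y" if "(x, y) \<in> H" for x y
  proof
    assume "2 * int n dvd x - y"
    then have "gap n (x, y) = 0" by (simp add: gap_def dvd_eq_mod_eq_0)
    moreover have "gap n (x, y) \<in> {1..<int n}" using that unfolding gap_image[symmetric] by blast
    ultimately show False by simp
  qed
  moreover have "\<not> 2 * int n dvd x - (x + int n)" for x
    using n0 zdvd_not_zless[of "int n" "2 * int n"] by simp
  ultimately have "edge_pair n (x + t, y + t) \<subseteq> complete_edges V" if "(x, y) \<in> H \<union> (\<lambda>x. (x, x + int n)) ` S" for x y
    using that by (intro *) auto
  moreover have "{2 * n + i, vtx n z} \<in> complete_edges V" if "i < length ys" for i z
    using that vtx_less[OF n0, of z] by (auto simp: doubleton_complete_edges)
  ultimately show ?thesis unfolding factor_def by fast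
qed

section \<open>The edge multiset of the family of translates\<close>

lemma finite_complete_edges: "finite (complete_edges V)"
  by (rule finite_subset[of _ "Pow V"]) (auto simp: complete_edges_def)

definition family :: "nat set set multiset" where
  "family = image_mset (\<lambda>t. factor (int t)) (mset_set {..<n})"

lemma count_family: "count (\<Sum>G\<in>#family. mset_set G) e = card {t. t < n \<and> e \<in> factor (int t)}"
proof -
  have fin: "finite (factor t)" for t
    using factor_subset finite_complete_edges finite_subset by blast
  have "(\<Sum>G\<in>#family. mset_set G) = (\<Sum>t<n. mset_set (factor (int t)))"
    by (simp add: family_def sum_unfold_sum_mset image_mset.compositionality comp_def)
  then have "count (\<Sum>G\<in>#family. mset_set G) e = (\<Sum>t<n. if e \<in> factor (int t) then 1 else 0)"
    by (simp add: count_sum count_mset_set' fin)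
  also have "\<dots> = card ({..<n} \<inter> {t. e \<in> factor (int t)})"
    by (simp add: sum.If_cases)
  also have "{..<n} \<inter> {t. e \<in> factor (int t)} = {t. t < n \<and> e \<in> factor (int t)}" by auto
  finally show ?thesis .
qed

lemma inner_mem_antipodal: "{vtx n a, vtx n b} \<in> antipodal \<longleftrightarrow> 2 * int n dvd a - b - int n"
proof -
  have ep: "{{x, x + n}} = edge_pair n (int x, int x + int n)" if "x < n" for x
  proof -
    have "vtx n (int x) = x" "vtx n (int x + int n) = x + n"
      using that vtx_of_nat[of x n] vtx_of_nat[of "x + n" n] by simp_all
    then show ?thesis using vtx_add_period[OF n0, of "int x"] by (auto simp: edge_pair_def)
  qed
  have "{vtx n a, vtx n b} \<in> antipodal \<longleftrightarrow> (\<exists>x<n. {vtx n a, vtx n b} \<in> {{x, x + n}})"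
    unfolding antipodal_def using vtx_ne[of _ 0] vtx_ne[of _ 1] by (auto simp: doubleton_eq_iff)
  also have "\<dots> \<longleftrightarrow> (\<exists>x<n. {vtx n a, vtx n b} \<in> edge_pair n (int x, int x + int n))"
    by (intro ex_cong1 conj_cong refl) (simp only: ep)
  also have "\<dots> \<longleftrightarrow> 2 * int n dvd a - b - int n"
  proof
    assume "\<exists>x<n. {vtx n a, vtx n b} \<in> edge_pair n (int x, int x + int n)"
    then consider "2 * int n dvd a - b + int n" | "2 * int n dvd b - a + int n"
      unfolding mem_edge_pair_iff[OF n0] by auto
    then show "2 * int n dvd a - b - int n"
    proof cases
      case 1
      then have "2 * int n dvd (a - b + int n) - 2 * int n" by (metis dvd_diff dvd_refl)
      then show ?thesis by (simp add: algebra_simps)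
    next
      case 2
      have "a - b - int n = - (b - a + int n)" by simp
      then show ?thesis using 2 by (metis dvd_minus_iff)
    qed
  next
    assume "2 * int n dvd a - b - int n"
    then have "2 * int n dvd (a - b - int n) + 2 * int n" by (metis dvd_add dvd_refl)
    then have "2 * int n dvd (a - b) - (c - (c + int n))" for c by (simp add: algebra_simps)
    moreover have "nat (a mod int n) < n" "int n dvd a - int (nat (a mod int n))"
      using n0 by (auto simp: nat_less_iff mod_eq_dvd_iff[symmetric])
    ultimately show "\<exists>x<n. {vtx n a, vtx n b} \<in> edge_pair n (int x, int x + int n)"
      unfolding mem_edge_pair_iff[OF n0] by blast
  qed
  finally show ?thesis .
qed

lemma count_family_eq:
  "count (\<Sum>G\<in>#family. mset_set G) e =
     (if e \<in> complete_edges V then if e \<in> antipodal then card S else 1 else 0)"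
proof (cases "e \<in> complete_edges V")
  case True
  then show ?thesis using n0
  proof (cases rule: edge_cases)
    case (inner a b)
    then show ?thesis
      using True card_inner[of a b] card_antipodal[of a b] inner_mem_antipodal[of a b]
      by (auto simp: count_family)
  next
    case (mixed i b)
    have "e \<notin> antipodal"
      using mixed vtx_less[OF n0, of b] by (auto simp: antipodal_def doubleton_eq_iff)
    then show ?thesis using True mixed card_mixed[of i b] by (simp add: count_family)
  next
    case (outer i j)
    \<comment> \<open>Two fixed vertices leave \<open>S\<close> empty, so the uncovered edge between
      them has multiplicity \<open>card S\<close>, like the other edges of
      \<open>antipodal\<close>.\<close>
    then have "length ys = 2" "i = 0" "j = 1" using S_card by auto
    then have "e \<in> antipodal" "card S = 0" using outer S_card by (auto simp: antipodal_def)
    then show ?thesis using True outer card_outer[of i j] by (simp add: count_family)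
  qed
next
  case False
  then have "e \<notin> factor t" for t using factor_subset by blast
  then show ?thesis using False by (simp add: count_family)
qed

lemma one_factor_antipodal:
  assumes "length ys \<noteq> 1"
  shows "one_factor V antipodal"
  unfolding one_factor_def
proof (intro conjI ballI)
  have l: "length ys = 0 \<or> length ys = 2" using assms S_card by linarith
  show "antipodal \<subseteq> complete_edges V"
    using n0 by (auto simp: antipodal_def doubleton_complete_edges split: if_splits)
  fix x assume x: "x \<in> V"
  consider "x < n" | "n \<le> x" "x < 2 * n" | "2 * n \<le> x" "length ys = 2" using x l by force
  then show "\<exists>!e. e \<in> antipodal \<and> x \<in> e"
  proof cases
    case 1
    then show ?thesis by (intro ex1I[of _ "{x, x + n}"]) (auto simp: antipodal_def split: if_splits)
  next
    case 2
    then show ?thesis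
      by (intro ex1I[of _ "{x - n, x}"]) (auto simp: antipodal_def split: if_splits intro!: exI[of _ "x - n"])
  next
    case 3
    then have "x = 2 * n \<or> x = 2 * n + 1" using x by auto
    then show ?thesis using 3
      by (intro ex1I[of _ "{2 * n, 2 * n + 1}"]) (auto simp: antipodal_def split: if_splits)
  qed
qed

lemma K_sigma_family:
  assumes "int (card S) = 1 + \<sigma>"
  shows "K_sigma V \<sigma> (\<Sum>G\<in>#family. mset_set G)"
proof -
  have sub: "antipodal \<subseteq> complete_edges V" if "length ys \<noteq> 1"
    using one_factor_antipodal[OF that] by (simp add: one_factor_def)
  have fin: "finite antipodal" unfolding antipodal_def by auto
  consider "\<sigma> = -1" "card S = 0" | "\<sigma> = 0" "card S = 1" | "\<sigma> = 1" "card S = 2"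
    using assms S_card by linarith
  then show ?thesis
  proof cases
    case 1
    then have "(\<Sum>G\<in>#family. mset_set G) = mset_set (complete_edges V) - mset_set antipodal"
      by (intro multiset_eqI) (simp add: count_family_eq count_mset_set' finite_complete_edges fin)
    then show ?thesis using 1 S_card one_factor_antipodal by (auto simp: K_sigma_def)
  next
    case 2
    then have "(\<Sum>G\<in>#family. mset_set G) = mset_set (complete_edges V)"
      by (intro multiset_eqI) (simp add: count_family_eq count_mset_set' finite_complete_edges)
    then show ?thesis using 2 by (simp add: K_sigma_def)
  next
    case 3
    then have l: "length ys \<noteq> 1" using S_card by simp
    have "(\<Sum>G\<in>#family. mset_set G) = mset_set (complete_edges V) + mset_set antipodal"
      using sub[OF l] 3
      by (intro multiset_eqI) (auto simp: count_family_eq count_mset_set' finite_complete_edges fin)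
    then show ?thesis using 3 one_factor_antipodal[OF l] by (auto simp: K_sigma_def)
  qed
qed

section \<open>The rotation group and its action on the family\<close>

definition rot :: "int \<Rightarrow> nat \<Rightarrow> nat" where
  "rot t x = (if x < 2 * n then vtx n (int x + t) else x)"

lemma rot_vtx: "rot t (vtx n z) = vtx n (z + t)"
  using vtx_less[OF n0, of z] n0 by (simp add: rot_def vtx_def mod_simps)

lemma rot_add: "rot s (rot t x) = rot (s + t) x"
proof (cases "x < 2 * n")
  case True
  then have "rot t x = vtx n (int x + t)" by (simp add: rot_def)
  then show ?thesis using True by (simp only: rot_vtx) (simp add: rot_def algebra_simps)
qed (simp add: rot_def)

lemma rot_zero: "rot 0 x = x"
  by (simp add: rot_def vtx_of_nat)

lemma rot_in_V: "rot t x \<in> V \<longleftrightarrow> x \<in> V"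
  using vtx_less[OF n0, of "int x + t"] by (auto simp: rot_def)

lemma bij_rot: "bij_betw (rot t) V V"
  by (rule bij_betwI[where g = "rot (- t)"]) (use rot_in_V in \<open>auto simp: rot_add rot_zero\<close>)

lemma rot_factor: "(\<lambda>e. rot t ` e) ` factor s = factor (s + t)"
proof -
  have *: "z + s + t = z + (s + t)" "z + s + int n + t = z + (s + t) + int n" for z by simp_all
  have 1: "(\<lambda>e. rot t ` e) ` edge_pair n (x + s, y + s) = edge_pair n (x + (s + t), y + (s + t))" for x y
    by (simp only: edge_pair_def rot_vtx image_insert image_empty fst_conv snd_conv *)
  have "rot t (2 * n + i) = 2 * n + i" for i by (simp add: rot_def)
  then have 2: "(\<lambda>e. rot t ` e) ` {{2 * n + i, vtx n (z + s)}, {2 * n + i, vtx n (z + s + int n)}}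
     = {{2 * n + i, vtx n (z + (s + t))}, {2 * n + i, vtx n (z + (s + t) + int n)}}" for i z
    by (simp only: rot_vtx image_insert image_empty *)
  show ?thesis
    unfolding factor_def image_Un[of "\<lambda>e. rot t ` e"] image_UN 2
    by (intro arg_cong2[where f = union] SUP_cong refl) (simp only: split_beta 1)
qed

lemma factor_isomorphic:
  assumes "isomorphic F (V, factor 0)"
  shows "isomorphic F (V, factor t)"
proof -
  obtain \<phi> where "bij_betw \<phi> (verts F) V" "factor 0 = (\<lambda>e. \<phi> ` e) ` edges F"
    using assms by (auto simp: isomorphic_def)
  moreover have "factor t = (\<lambda>e. rot t ` e) ` factor 0" using rot_factor[of t 0] by simp
  ultimately have "bij_betw (rot t \<circ> \<phi>) (verts F) V" "factor t = (\<lambda>e. (rot t \<circ> \<phi>) ` e) ` edges F"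
    using bij_betw_trans[OF _ bij_rot] by (auto simp: image_image image_comp)
  then show ?thesis by (auto simp: isomorphic_def)
qed

text \<open>The elements of \<open>BijGroup V\<close> are extensional functions, hence the
  restriction to \<open>V\<close>.\<close>

definition rotations :: "(nat \<Rightarrow> nat) set" where
  "rotations = range (\<lambda>t. restrict (rot t) V)"

lemma restrict_rot_Bij: "restrict (rot t) V \<in> Bij V"
  using bij_rot[of t] by (auto simp: Bij_def bij_betw_restrict_eq)

lemma compose_rot: "compose V (restrict (rot s) V) (restrict (rot t) V) = restrict (rot (s + t)) V"
  using rot_in_V by (auto simp: compose_def rot_add restrict_def fun_eq_iff)

lemma subgroup_rotations: "subgroup rotations (BijGroup V)"
proof -
  interpret G: group "BijGroup V" by (rule group_BijGroup)
  have one: "\<one>\<^bsub>BijGroup V\<^esub> = restrict (rot 0) V"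
    by (simp add: BijGroup_def rot_zero restrict_def fun_eq_iff)
  have mult: "restrict (rot s) V \<otimes>\<^bsub>BijGroup V\<^esub> restrict (rot t) V = restrict (rot (s + t)) V" for s t
    using restrict_rot_Bij compose_rot by (simp add: BijGroup_def)
  have carr: "restrict (rot t) V \<in> carrier (BijGroup V)" for t
    using restrict_rot_Bij by (simp add: BijGroup_def)
  have inv: "inv\<^bsub>BijGroup V\<^esub> restrict (rot t) V = restrict (rot (- t)) V" for t
    by (rule G.inv_equality) (use carr mult one in simp_all)
  show ?thesis
    by (rule G.subgroupI) (use carr mult inv in \<open>auto simp: rotations_def\<close>)
qed

lemma automorphism_rotation:
  assumes "g \<in> rotations"
  shows "automorphism V family g"
proof -
  obtain t where g: "g = restrict (rot t) V" using assms by (auto simp: rotations_def)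
  have "(\<lambda>e. g ` e) ` factor s \<in># family" for s
  proof -
    have "e \<subseteq> V" if "e \<in> factor s" for e
      using that factor_subset by (auto simp: complete_edges_def)
    then have "g ` e = rot t ` e" if "e \<in> factor s" for e
      using that unfolding g by (intro image_cong) auto
    then have "(\<lambda>e. g ` e) ` factor s = factor (s + t)"
      using rot_factor[of t s] by (metis (no_types, lifting) image_cong)
    also have "\<dots> = factor ((s + t) mod int n)" by (simp add: factor_mod)
    finally have *: "(\<lambda>e. g ` e) ` factor s = factor ((s + t) mod int n)" .
    obtain k where "k < n" "(s + t) mod int n = int k"
      using n0 by (metis nonneg_int_cases of_nat_0_less_iff of_nat_less_iff pos_mod_bound pos_mod_sign)
    then show ?thesis unfolding * by (auto simp: family_def)
  qed
  then show ?thesis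
    using restrict_rot_Bij by (auto simp: automorphism_def g family_def)
qed

lemma pyramidal_family: "pyramidal (length ys) V family"
proof -
  have fixed: "{x \<in> V. \<forall>g\<in>rotations. g x = x} = {2 * n..<2 * n + length ys}" (is "?Fix = _")
  proof (intro equalityI subsetI)
    fix x assume x: "x \<in> ?Fix"
    then have "restrict (rot 1) V x = x" by (auto simp: rotations_def)
    then have rot: "rot 1 x = x" using x by simp
    have "\<not> x < 2 * n"
    proof
      assume "x < 2 * n"
      then have "vtx n (int x + 1) = vtx n (int x)" using rot by (simp add: rot_def vtx_of_nat)
      then have "2 * int n dvd 1" by (simp add: vtx_eq_iff[OF n0])
      then show False using n by (simp add: zdvd1_eq)
    qed
    then show "x \<in> {2 * n..<2 * n + length ys}" using x by simp
  qed (auto simp: rotations_def rot_def)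
  have trans: "\<exists>!g. g \<in> rotations \<and> g x = y" if "x < 2 * n" "y < 2 * n" for x y
  proof (rule ex1I[of _ "restrict (rot (int y - int x)) V"])
    show "restrict (rot (int y - int x)) V \<in> rotations \<and> restrict (rot (int y - int x)) V x = y"
      using that by (auto simp: rotations_def rot_def vtx_of_nat)
    fix g assume g: "g \<in> rotations \<and> g x = y"
    then obtain t where t: "g = restrict (rot t) V" by (auto simp: rotations_def)
    then have "vtx n (int x + t) = vtx n (int y)"
      using g that by (simp add: rot_def vtx_of_nat)
    then have "2 * int n dvd (int x + t) - int y" by (simp add: vtx_eq_iff[OF n0])
    then have "vtx n (int z + t) = vtx n (int z + (int y - int x))" for z
      by (simp add: vtx_eq_iff[OF n0] algebra_simps)
    then show "g = restrict (rot (int y - int x)) V" by (simp add: t rot_def restrict_def fun_eq_iff)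
  qed
  have "V - {2 * n..<2 * n + length ys} = {..<2 * n}" by auto
  with subgroup_rotations automorphism_rotation trans show ?thesis
    unfolding pyramidal_def Let_def
    by (intro exI[of _ rotations]) (simp only: fixed, simp)
qed

lemma pyramidal_solution:
  assumes "int (card S) = 1 + \<sigma>" "isomorphic F (V, factor 0)" "card (verts F) = 2 * n + length ys"
  shows "has_pyramidal_solution (nat (1 - \<sigma>)) \<sigma> F"
proof -
  have "length ys = nat (1 - \<sigma>)" using assms(1) S_card by linarith
  moreover have "OP_solution \<sigma> F V family"
    unfolding OP_solution_def factorization_def
    using K_sigma_family[OF assms(1)] factor_isomorphic[OF assms(2)] by (auto simp: family_def)
  ultimately show ?thesis
    using pyramidal_family assms(3) unfolding has_pyramidal_solution_def by metis
qed

end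

section \<open>From labellings to starters\<close>

definition cycle_edges :: "'a list \<Rightarrow> 'a set set" where
  "cycle_edges c = {{c ! x, c ! (Suc x mod length c)} | x. x < length c}"

lemma card_cycle_union: "card (verts (cycle_union ns)) = sum_list ns"
  by (simp add: cycle_union_def sum_list_sum_nth atLeast0LessThan)

text \<open>The map sending a position to its entry is onto \<open>V\<close>, and there are as many
  positions as vertices because the entries are distinct, so it is a bijection.\<close>

lemma isomorphic_cycle_union:
  assumes "distinct (concat css)" "set (concat css) = V"
  shows "isomorphic (cycle_union (map length css)) (V, \<Union>c\<in>set css. cycle_edges c)"
proof -
  let ?ns = "map length css" and ?f = "\<lambda>(i, x). css ! i ! x"
  let ?A = "SIGMA i:{..<length css}. {..<length (css ! i)}"
  have A: "verts (cycle_union ?ns) = ?A"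
    by (auto simp: cycle_union_def)
  have "?f ` ?A = V"
    using assms(2) by (force simp: in_set_conv_nth image_iff)
  moreover have "card ?A = length (concat css)"
    by (simp add: length_concat sum_list_sum_nth atLeast0LessThan)
  then have "card ?A = card V" using assms distinct_card by metis
  ultimately have "bij_betw ?f ?A V" by (auto simp: bij_betw_def intro: eq_card_imp_inj_on)
  moreover have "(\<Union>c\<in>set css. cycle_edges c) = (\<lambda>e. ?f ` e) ` edges (cycle_union ?ns)"
  proof -
    have "(\<Union>c\<in>set css. cycle_edges c) = (\<Union>i<length css. cycle_edges (css ! i))"
    proof -
      have "set css = (!) css ` {..<length css}" by (auto simp: set_conv_nth)
      then show ?thesis by simp
    qed
    also have "\<dots> = (\<lambda>e. ?f ` e) ` edges (cycle_union ?ns)"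
    proof (intro equalityI subsetI)
      fix e assume "e \<in> (\<Union>i<length css. cycle_edges (css ! i))"
      then obtain i x where ix: "i < length css" "x < length (css ! i)"
        "e = {css ! i ! x, css ! i ! (Suc x mod length (css ! i))}"
        by (auto simp: cycle_edges_def)
      then have "{(i, x), (i, Suc x mod length (css ! i))} \<in> edges (cycle_union ?ns)"
        using ix by (simp add: cycle_union_def) (rule exI[of _ i], rule exI[of _ x], simp)
      then show "e \<in> (\<lambda>e. ?f ` e) ` edges (cycle_union ?ns)"
        by (rule rev_image_eqI) (simp add: ix)
    next
      fix e assume "e \<in> (\<lambda>e. ?f ` e) ` edges (cycle_union ?ns)"
      then show "e \<in> (\<Union>i<length css. cycle_edges (css ! i))"
        by (force simp: cycle_union_def cycle_edges_def)
    qed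
    finally show ?thesis .
  qed
  ultimately show ?thesis unfolding isomorphic_def A fst_conv snd_conv by blast
qed

definition pairs :: "'a list \<Rightarrow> ('a \<times> 'a) list" where
  "pairs xs = zip xs (tl xs)"

definition und :: "'a \<times> 'a \<Rightarrow> 'a set" where
  "und p = {fst p, snd p}"

lemma pairs_simps [simp]:
  "pairs [] = []" "pairs [x] = []" "pairs (x # y # xs) = (x, y) # pairs (y # xs)"
  by (simp_all add: pairs_def)

lemma pairs_Cons: "ys \<noteq> [] \<Longrightarrow> pairs (x # ys) = (x, hd ys) # pairs ys"
  by (cases ys) auto

lemma pairs_append:
  "xs \<noteq> [] \<Longrightarrow> ys \<noteq> [] \<Longrightarrow> pairs (xs @ ys) = pairs xs @ (last xs, hd ys) # pairs ys"
proof (induction xs rule: induct_list012)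
  case (2 x)
  then show ?case by (cases ys) auto
qed auto

lemma pairs_map: "pairs (map f xs) = map (map_prod f f) (pairs xs)"
  by (induction xs rule: induct_list012) auto

lemma und_pairs_rev: "und ` set (pairs (rev xs)) = und ` set (pairs xs)"
proof (induction xs rule: induct_list012)
  case (3 x y zs)
  then show ?case
    using pairs_append[of "rev (y # zs)" "[x]"] by (auto simp: und_def last_rev insert_commute)
qed auto

lemma length_pairs: "length (pairs xs) = length xs - 1"
  by (simp add: pairs_def)

lemma in_pairs: "(x, y) \<in> set (pairs xs) \<Longrightarrow> x \<in> set xs \<and> y \<in> set xs"
  by (cases xs) (auto simp: pairs_def dest: set_zip_leftD set_zip_rightD)

lemma cycle_edges_pairs:
  assumes "c \<noteq> []"
  shows "cycle_edges c = und ` insert (last c, hd c) (set (pairs c))"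
proof (intro equalityI subsetI)
  fix e assume "e \<in> cycle_edges c"
  then obtain x where x: "x < length c" "e = {c ! x, c ! (Suc x mod length c)}"
    by (auto simp: cycle_edges_def)
  show "e \<in> und ` insert (last c, hd c) (set (pairs c))"
  proof (cases "Suc x = length c")
    case True
    then have "e = und (last c, hd c)"
      using x assms by (simp add: und_def last_conv_nth hd_conv_nth flip: True)
    then show ?thesis by blast
  next
    case False
    then have "(c ! x, c ! Suc x) \<in> set (pairs c)"
      using x by (auto simp: pairs_def set_zip nth_tl intro!: exI[of _ x])
    then show ?thesis using False x by (intro rev_image_eqI[of "(c ! x, c ! Suc x)"]) (auto simp: und_def)
  qed
next
  fix e assume "e \<in> und ` insert (last c, hd c) (set (pairs c))"
  then consider "e = und (last c, hd c)" | p where "p \<in> set (pairs c)" "e = und p" by blast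
  then show "e \<in> cycle_edges c"
  proof cases
    case 1
    then show ?thesis using assms
      by (auto simp: cycle_edges_def und_def last_conv_nth hd_conv_nth intro!: exI[of _ "length c - 1"])
  next
    case 2
    then obtain x where "Suc x < length c" "p = (c ! x, c ! Suc x)"
      by (auto simp: pairs_def set_zip nth_tl less_diff_conv)
    then show ?thesis using 2 by (auto simp: cycle_edges_def und_def intro!: exI[of _ x])
  qed
qed

text \<open>Representatives modulo \<open>2 * N\<close> of the vertices of a path, switching between \<open>x\<close> and \<open>x + N\<close>
  along each edge whose difference lies in \<open>D\<close>; the current offset is \<open>b\<close>.\<close>

fun lift :: "int \<Rightarrow> int set \<Rightarrow> int \<Rightarrow> int list \<Rightarrow> int list" where
  "lift N D b (x # y # xs) = (x + b) # lift N D (if \<bar>x - y\<bar> \<in> D then N - b else b) (y # xs)"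
| "lift N D b [x] = [x + b]"
| "lift N D b [] = []"

lemma lift_Nil_iff [simp]: "lift N D b xs = [] \<longleftrightarrow> xs = []"
  by (induction N D b xs rule: lift.induct) auto

lemma length_lift [simp]: "length (lift N D b xs) = length xs"
  by (induction N D b xs rule: lift.induct) auto

lemma hd_lift [simp]: "xs \<noteq> [] \<Longrightarrow> hd (lift N D b xs) = hd xs + b"
  by (induction N D b xs rule: lift.induct) auto

lemma map_mod_lift:
  "b \<in> {0, N} \<Longrightarrow> set xs \<subseteq> {0..<N} \<Longrightarrow> map (\<lambda>z. z mod N) (lift N D b xs) = xs"
  by (induction N D b xs rule: lift.induct) auto

lemma gap_eqI:
  assumes "0 < n" "0 \<le> d" "d \<le> int n" "2 * int n dvd (x - y) - d \<or> 2 * int n dvd (y - x) - d"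
  shows "gap n (x, y) = d"
proof -
  have "gap n (x, y) = gap n (d, 0)" using assms by (simp add: gap_eq_iff)
  also have "\<dots> = d" using assms by (simp add: gap_def)
  finally show ?thesis .
qed

lemma gap_abs:
  assumes "0 < n" "x \<in> {0..<int n}" "y \<in> {0..<int n}"
  shows "gap n (x, y) = \<bar>x - y\<bar>" "gap n (x, y + int n) = int n - \<bar>x - y\<bar>" "gap n (x + int n, y) = int n - \<bar>x - y\<bar>"
    "gap n (x + int n, y + int n) = \<bar>x - y\<bar>"
  using assms by (auto intro!: gap_eqI simp: abs_if)

lemma steps_pairs: "steps xs = (\<lambda>(x, y). \<bar>x - y\<bar>) ` set (pairs xs)"
  by (induction xs rule: steps.induct) auto

text \<open>Switching the offset along an edge of difference \<open>d\<close> adds \<open>n\<close>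
  to it modulo \<open>2 * n\<close>, which turns the length \<open>d\<close> into
  \<open>n - d\<close>.\<close>

lemma gap_lift:
  assumes "0 < n" "b \<in> {0, int n}" "set xs \<subseteq> {0..<int n}"
  shows "gap n ` set (pairs (lift (int n) D b xs)) = (\<lambda>d. if d \<in> D then int n - d else d) ` steps xs"
  using assms(2,3)
proof (induction xs arbitrary: b rule: steps.induct)
  case (1 x y xs)
  define b' where "b' = (if \<bar>x - y\<bar> \<in> D then int n - b else b)"
  have b': "b' \<in> {0, int n}" using 1 by (auto simp: b'_def)
  obtain zs where zs: "lift (int n) D b' (y # xs) = (y + b') # zs" by (cases xs) auto
  have "gap n (x + b, y + b') = (if \<bar>x - y\<bar> \<in> D then int n - \<bar>x - y\<bar> else \<bar>x - y\<bar>)"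
    using 1 gap_abs[OF assms(1), of x y] by (auto simp: b'_def)
  then show ?case using 1(1)[OF b'] 1(3) zs by (simp flip: b'_def)
qed auto



section \<open>The starter obtained from a labelling\<close>

lemma block_pyramidal:
  fixes P :: "int list"
  assumes B: "block 0 (int n) cs P" and P: "2 \<le> length P" and \<sigma>: "\<sigma> \<in> {-1, 0, 1}"
  shows "has_pyramidal_solution (nat (1 - \<sigma>)) \<sigma>
    (cycle_union ((2 * length P + nat (1 - \<sigma>)) # map (\<lambda>c. 2 * length c) (take r cs) @
       concat (map (\<lambda>c. [length c, length c]) (drop r cs))))"
proof -
  define tw un where "tw = take r cs" and "un = drop r cs"
  \<comment> \<open>Twisting \<open>c\<close> changes the length of its closing edge to
    \<open>n - closing c\<close>. The path edge of that difference is switched in turn and then has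
    the lost length \<open>closing c\<close>.\<close>
  define D where "D = (\<lambda>c. int n - closing c) ` set tw"
  define Q where "Q = lift (int n) D 0 P"
  have cs: "cs = tw @ un" by (simp add: tw_def un_def)
  have len: "length (concat cs) + length P = n" and verts: "set (concat cs @ P) = {0..<int n}"
    and ne: "[] \<notin> set cs" "P \<noteq> []"
    using B by (auto simp: block_def simp flip: of_nat_add)
  have n: "2 \<le> n" "0 < n" using len P by auto
  have cne: "c \<noteq> []" if "c \<in> set cs" for c using ne that by auto
  have range: "set P \<subseteq> {0..<int n}" "c \<in> set cs \<Longrightarrow> set c \<subseteq> {0..<int n}" for c
    using verts by auto
  have ends: "hd c \<in> {0..<int n}" "last c \<in> {0..<int n}" if "c \<in> set cs" for c
    using range(2)[OF that] cne[OF that] hd_in_set last_in_set by blast+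
  have "card (set (concat cs @ P)) = length (concat cs @ P)" unfolding verts using len by simp
  then have "distinct P" using card_distinct distinct_append by blast
  then have PP: "hd P \<noteq> last P" using P by (cases P rule: remdups_adj.cases) auto
  have Q: "Q \<noteq> []" "length Q = length P" "map (\<lambda>z. z mod int n) Q = P"
    using ne range map_mod_lift[of 0 "int n" P D] by (simp_all add: Q_def)
  have Qmod: "hd Q mod int n = hd P" "last Q mod int n = last P"
    using Q(1) by (simp_all add: hd_map last_map flip: Q(3))
  define tp up where "tp c = pairs c @ [(last c, hd c + int n)]" and "up c = pairs c @ [(last c, hd c)]" for c :: "int list"
  define HL where "HL = pairs Q @ concat (map tp tw) @ concat (map up un)"
  define H where "H = set HL"
  have gap_steps: "d \<in> gap n ` set (pairs c)" if c: "c \<in> set cs" and d: "d \<in> steps c" for c d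
  proof -
    obtain x y where xy: "(x, y) \<in> set (pairs c)" "d = \<bar>x - y\<bar>" using d by (auto simp: steps_pairs)
    then have "x \<in> {0..<int n}" "y \<in> {0..<int n}" using range(2)[OF c] in_pairs[OF xy(1)] by blast+
    then have "gap n (x, y) = d" using gap_abs(1)[of n x y] n xy by simp
    then show ?thesis using xy by (metis image_eqI)
  qed
  have gap_Q: "gap n ` set (pairs Q) = (\<lambda>d. if d \<in> D then int n - d else d) ` steps P"
    unfolding Q_def by (rule gap_lift) (use n range in auto)
  have H_eq: "H = set (pairs Q) \<union> (\<Union>c\<in>set tw. set (tp c)) \<union> (\<Union>c\<in>set un. set (up c))"
    by (auto simp: H_def HL_def)
  have cover: "{1..<int n} \<subseteq> gap n ` H"
  proof
    fix d assume d: "d \<in> {1..<int n}"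
    consider (path) "d \<in> steps P" "d \<notin> D" | (swap) "d \<in> D" | (cycle) c where "c \<in> set cs" "d \<in> steps c"
      | (tw) c where "c \<in> set tw" "d = closing c" | (un) c where "c \<in> set un" "d = closing c"
    proof -
      have "{1..<int n} \<subseteq> steps P \<union> (\<Union>c\<in>set cs. insert (closing c) (steps c))"
        using B by (simp add: block_def)
      then have "d \<in> steps P \<or> (\<exists>c\<in>set tw \<union> set un. d = closing c \<or> d \<in> steps c)"
        using d by (auto simp: cs)
      then show ?thesis using path swap cycle tw un by (auto simp: cs)
    qed
    then show "d \<in> gap n ` H"
    proof cases
      case path
      then have "d \<in> gap n ` set (pairs Q)" unfolding gap_Q by force
      then show ?thesis by (auto simp: H_eq)
    next
      case swap
      then obtain c where c: "c \<in> set tw" "d = int n - closing c" by (auto simp: D_def)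
      then have "gap n (last c, hd c + int n) = d" using ends[of c] n by (simp add: cs gap_abs)
      moreover have "(last c, hd c + int n) \<in> H" using c by (auto simp: H_eq tp_def)
      ultimately show ?thesis by (metis image_eqI)
    next
      case cycle
      then have "set (pairs c) \<subseteq> H" by (auto simp: H_eq cs tp_def up_def)
      then show ?thesis using gap_steps[OF cycle] by blast
    next
      case tw
      then have "int n - d \<in> steps P" using B by (auto simp: block_def cs)
      moreover have "int n - d \<in> D" using tw by (auto simp: D_def)
      ultimately have "d \<in> gap n ` set (pairs Q)" unfolding gap_Q by force
      then show ?thesis by (auto simp: H_eq)
    next
      case un
      then have "gap n (last c, hd c) = d" using ends[of c] n by (simp add: cs gap_abs)
      moreover have "(last c, hd c) \<in> H" using un by (auto simp: H_eq up_def)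
      ultimately show ?thesis by (metis image_eqI)
    qed
  qed
  have "length (tp c) = length c" "length (up c) = length c" if "c \<in> set cs" for c
    using cne[OF that] by (simp_all add: tp_def up_def length_pairs Suc_leI)
  then have "map length (map tp tw) = map length tw" "map length (map up un) = map length un"
    by (auto simp: cs)
  then have lenHL: "length HL = n - 1"
    using len Q P by (simp add: HL_def length_pairs length_concat cs del: map_map)
  \<comment> \<open>There are \<open>n - 1\<close> edges and they realise all \<open>n - 1\<close>
    lengths, so each length occurs exactly once.\<close>
  have card_H: "card H \<le> n - 1" unfolding H_def using card_length[of HL] lenHL by simp
  have "card {1..<int n} \<le> card (gap n ` H)" using cover by (intro card_mono) (auto simp: H_def)
  moreover have "card (gap n ` H) \<le> card H" by (rule card_image_le) (simp add: H_def)
  ultimately have cards: "card (gap n ` H) = card {1..<int n}" "card (gap n ` H) = card H" using card_H by auto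
  have gap_image: "gap n ` H = {1..<int n}"
    using card_subset_eq[OF _ cover] cards(1) by (simp add: H_def)
  have gap_inj: "inj_on (gap n) H" using cards(2) by (intro eq_card_imp_inj_on) (simp_all add: H_def)
  \<comment> \<open>Each end of \<open>Q\<close> is connected with its shift by \<open>n\<close>
    either directly, through an edge of difference \<open>n\<close>, or through a fixed vertex. The
    value of \<open>\<sigma>\<close> says how many of the two connections are direct.\<close>
  define S where "S = (if \<sigma> = 0 then {last Q} else if \<sigma> = 1 then {hd Q, last Q} else {})"
  define ys where "ys = (if \<sigma> = 0 then [hd Q] else if \<sigma> = 1 then [] else [hd Q, last Q])"
  have QQ: "hd Q \<noteq> last Q" using PP Qmod by auto
  have cardS: "int (card S) = 1 + \<sigma>" "card S + length ys = 2"
    using \<sigma> QQ by (auto simp: S_def ys_def)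
  interpret starter n H S ys
  proof
    show "inj_on (\<lambda>x. x mod int n) S" using PP Qmod by (auto simp: S_def)
  qed (use n gap_inj gap_image cardS in \<open>auto simp: S_def\<close>)
  have lys: "length ys = nat (1 - \<sigma>)" using cardS by linarith

  define v v' where "v = vtx n" and "v' z = vtx n (z + int n)" for z
  \<comment> \<open>The long cycle runs along \<open>Q\<close> and returns along the shifted copy in
    reverse, which closes it up at both ends.\<close>
  define big where "big = (if \<sigma> = 1 then [] else [2 * n]) @ map v Q @ (if \<sigma> = -1 then [2 * n + 1] else []) @ rev (map v' Q)"
  define css where "css = big # map (\<lambda>c. map v c @ map v' c) tw @ concat (map (\<lambda>c. [map v c, map v' c]) un)"
  have map_len: "map length css = (2 * length P + nat (1 - \<sigma>)) # map (\<lambda>c. 2 * length c) (take r cs) @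
       concat (map (\<lambda>c. [length c, length c]) (drop r cs))"
    using \<sigma> Q(2) by (auto simp: css_def big_def map_concat comp_def tw_def un_def)
  have "length (concat css) = 2 * n + length ys"
  proof -
    have "sum_list (concat (map (\<lambda>c. [length c, length c]) un)) = 2 * length (concat un)"
      by (induction un) auto
    moreover have "sum_list (map (\<lambda>c. 2 * length c) tw) = 2 * length (concat tw)"
      by (induction tw) auto
    ultimately show ?thesis
      using len lys by (simp add: length_concat map_len flip: tw_def un_def) (simp add: cs length_concat)
  qed
  moreover have "V \<subseteq> set (concat css)"
  proof
    fix a assume a: "a \<in> V"
    show "a \<in> set (concat css)"
    proof (cases "a < 2 * n")
      case True
      have "int a mod int n \<in> set (concat cs @ P)" unfolding verts using n by simp
      then consider "int a mod int n \<in> (\<lambda>z. z mod int n) ` set Q" | c where "c \<in> set cs" "int a mod int n \<in> set c"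
        unfolding Q(3)[symmetric] by auto
      then obtain z xs where z: "z \<in> set xs" "xs = Q \<or> xs \<in> set cs" "int a mod int n = z mod int n"
        using range(2) by (metis imageE mod_mod_trivial)
      then have "int n dvd int a - z" by (simp add: mod_eq_dvd_iff)
      then obtain q where q: "int a - z = int n * q" by auto
      have "a = v z \<or> a = v' z"
      proof (cases "even q")
        case True
        then have "2 * int n dvd int a - z" using q by (auto simp: mult.commute)
        then have "vtx n (int a) = v z" using n by (simp add: v_def vtx_eq_iff)
        then show ?thesis using vtx_of_nat[OF \<open>a < 2 * n\<close>] by simp
      next
        case False
        then obtain q' where "q = 2 * q' + 1" by (rule oddE)
        then have "int a - (z + int n) = 2 * int n * q'" using q by (simp add: algebra_simps)
        then have "vtx n (int a) = v' z" using n by (simp add: v'_def vtx_eq_iff)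
        then show ?thesis using vtx_of_nat[OF \<open>a < 2 * n\<close>] by simp
      qed
      then show ?thesis using z(1,2) by (auto simp: css_def big_def cs)
    next
      case False
      then have "\<sigma> \<noteq> 1" "a = 2 * n \<or> \<sigma> = -1 \<and> a = 2 * n + 1" using a lys \<sigma> by auto
      then show ?thesis by (auto simp: css_def big_def)
    qed
  qed
  \<comment> \<open>The lists cover \<open>V\<close> and their total length is its size, so no
    vertex is repeated.\<close>
  ultimately have concat_V: "set (concat css) = V" and "distinct (concat css)"
  proof -
    assume *: "length (concat css) = 2 * n + length ys" "V \<subseteq> set (concat css)"
    then have "card (set (concat css)) \<le> card V" using card_length[of "concat css"] by simp
    then show "set (concat css) = V" using *(2) by (metis List.finite_set card_seteq)
    then show "distinct (concat css)" using *(1) by (intro card_distinct) simp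
  qed
  define E where "E X = (\<Union>p\<in>X. edge_pair n p)" for X
  have E_pairs: "E (set (pairs c)) = und ` set (pairs (map v c)) \<union> und ` set (pairs (map v' c))" for c
  proof -
    have "edge_pair n p = {und (map_prod v v p), und (map_prod v' v' p)}" for p
      by (simp add: edge_pair_def und_def v_def v'_def)
    then show ?thesis by (simp only: E_def pairs_map set_map image_image) blast
  qed
  have E_Un: "E (X \<union> Y) = E X \<union> E Y" "E (insert p X) = edge_pair n p \<union> E X" "E {} = {}" for X Y p by (auto simp: E_def)
  have ep: "edge_pair n (x, y) = {{v x, v y}, {v' x, v' y}}" for x y
    by (simp only: edge_pair_def v_def v'_def fst_conv snd_conv)
  have period: "v (z + int n) = v' z" "v' (z + int n) = v z" for z
    by (simp_all only: v_def v'_def vtx_add_period[OF n0])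
  \<comment> \<open>Passing from one copy of \<open>c\<close> to the other and back uses both edges
    of the pair of \<open>(last c, hd c + n)\<close>.\<close>
  have tw_edges: "cycle_edges (map v c @ map v' c) = E (set (tp c))" if "c \<in> set cs" for c
    using cne[OF that]
    by (auto simp: cycle_edges_pairs pairs_append image_Un tp_def E_Un E_pairs hd_map last_map ep und_def period)
  have un_edges: "cycle_edges (map v c) \<union> cycle_edges (map v' c) = E (set (up c))" if "c \<in> set cs" for c
    using cne[OF that] by (auto simp: cycle_edges_pairs up_def E_Un E_pairs hd_map last_map ep und_def)
  have antip: "edge_pair n (x, x + int n) = {{v x, v' x}}" for x
    unfolding ep period by (simp add: insert_commute)
  have big_edges: "cycle_edges big = E (set (pairs Q)) \<union> E ((\<lambda>x. (x, x + int n)) ` S) \<union>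
     (\<Union>i<length ys. {{2 * n + i, v (ys ! i)}, {2 * n + i, v' (ys ! i)}})"
  proof -
    define A B where "A = map v Q" and "B = rev (map v' Q)"
    have AB: "A \<noteq> []" "B \<noteq> []" "hd A = v (hd Q)" "last A = v (last Q)" "hd B = v' (last Q)" "last B = v' (hd Q)"
      using Q(1) by (simp_all add: A_def B_def hd_map last_map hd_rev last_rev)
    have EQ: "E (set (pairs Q)) = und ` set (pairs A) \<union> und ` set (pairs B)"
      by (simp only: E_pairs A_def B_def und_pairs_rev)
    have comm: "{v' (hd Q), v (hd Q)} = {v (hd Q), v' (hd Q)}" "{v' (hd Q), 2 * n} = {2 * n, v' (hd Q)}"
      "{v (last Q), Suc (2 * n)} = {Suc (2 * n), v (last Q)}"
      by (rule insert_commute)+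
    have big: "big = (if \<sigma> = 1 then [] else [2 * n]) @ A @ (if \<sigma> = -1 then [2 * n + 1] else []) @ B"
      by (simp add: big_def A_def B_def)
    consider "\<sigma> = -1" | "\<sigma> = 0" | "\<sigma> = 1" using \<sigma> by auto
    then show ?thesis
    proof cases
      case 1
      then have b: "big = [2 * n] @ A @ [Suc (2 * n)] @ B" by (simp add: big)
      have "cycle_edges big = und ` set (pairs A) \<union> und ` set (pairs B) \<union>
        {{2 * n, v (hd Q)}, {v (last Q), Suc (2 * n)}, {Suc (2 * n), v' (last Q)}, {v' (hd Q), 2 * n}}"
        unfolding b by (subst cycle_edges_pairs) (use AB in \<open>simp_all add: pairs_append pairs_Cons und_def image_Un Un_ac insert_commute\<close>)
      then show ?thesis
        using 1 unfolding comm EQ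
        by (simp add: S_def ys_def E_Un lessThan_Suc numeral_2_eq_2 Un_ac insert_commute)
    next
      case 2
      then have b: "big = [2 * n] @ A @ B" by (simp add: big)
      have "cycle_edges big = und ` set (pairs A) \<union> und ` set (pairs B) \<union>
        {{2 * n, v (hd Q)}, {v (last Q), v' (last Q)}, {v' (hd Q), 2 * n}}"
        unfolding b by (subst cycle_edges_pairs) (use AB in \<open>simp_all add: pairs_append pairs_Cons und_def image_Un Un_ac insert_commute\<close>)
      then show ?thesis
        using 2 unfolding comm EQ
        by (simp add: S_def ys_def E_Un antip lessThan_Suc Un_ac insert_commute)
    next
      case 3
      then have b: "big = A @ B" by (simp add: big)
      have "cycle_edges big = und ` set (pairs A) \<union> und ` set (pairs B) \<union>
        {{v (last Q), v' (last Q)}, {v' (hd Q), v (hd Q)}}"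
        unfolding b by (subst cycle_edges_pairs) (use AB in \<open>simp_all add: pairs_append pairs_Cons und_def image_Un Un_ac insert_commute\<close>)
      then show ?thesis
        using 3 unfolding comm EQ
        by (simp add: S_def ys_def E_Un antip Un_ac insert_commute)
    qed
  qed
  have "factor 0 = E (H \<union> (\<lambda>x. (x, x + int n)) ` S) \<union>
     (\<Union>i<length ys. {{2 * n + i, v (ys ! i)}, {2 * n + i, v' (ys ! i)}})"
    by (simp add: factor_def E_def v_def v'_def split_beta)
  also have "\<dots> = cycle_edges big \<union> (\<Union>c\<in>set tw. E (set (tp c))) \<union> (\<Union>c\<in>set un. E (set (up c)))"
    unfolding big_edges H_eq by (auto simp: E_def)
  also have "\<dots> = (\<Union>c\<in>set css. cycle_edges c)"
    using tw_edges un_edges by (auto simp: css_def cs)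
  finally have "factor 0 = (\<Union>c\<in>set css. cycle_edges c)" .
  then have iso: "isomorphic (cycle_union (map length css)) (V, factor 0)"
    using isomorphic_cycle_union[OF \<open>distinct (concat css)\<close> concat_V] by simp
  have "card (verts (cycle_union (map length css))) = 2 * n + length ys"
    using \<open>length (concat css) = 2 * n + length ys\<close> by (simp add: card_cycle_union length_concat)
  from pyramidal_solution[OF cardS(1) iso this] show ?thesis unfolding map_len .
qed

theorem theorem6p2:
  fixes s r h v L :: nat and l :: "nat \<Rightarrow> nat" and F :: "(nat \<times> nat) graph"
  assumes "r \<le> s" and "1 \<le> s" and "3 \<le> h"
    and "\<forall>i\<in>{1..s}. odd (l i)"
    and "\<forall>i\<in>{1..s}. 3 \<le> l i"
    and "strict_mono_on {1..r} l"
    and "F = cycle_union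
               (h # map (\<lambda>i. 2 * l i) [1..<r + 1] @ concat (map (\<lambda>j. [l j, l j]) [r + 1..<s + 1]))"
    and "v = card (verts F)"
    and "L = Max (l ` {1..s})"
    and "h > 7 ^ (s - 1) * (12 * L + 6)"
  shows "\<forall>\<sigma>\<in>{-1, 0, 1 :: int}. [int v - 1 = \<sigma>] (mod 2) \<longrightarrow>
           has_pyramidal_solution (nat (1 - \<sigma>)) \<sigma> F"
proof (intro ballI impI)
  fix \<sigma> :: int
  assume \<sigma>: "\<sigma> \<in> {-1, 0, 1}" and cong: "[int v - 1 = \<sigma>] (mod 2)"
  define ls where "ls = map l [1..<s + 1]"
  have set_ls: "set ls = l ` {1..s}" and len_ls: "length ls = s" by (auto simp: ls_def)
  have split: "take r ls = map l [1..<r + 1]" "drop r ls = map l [r + 1..<s + 1]"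
    using take_upt[of 1 r "s + 1"] assms(1) unfolding ls_def take_map drop_map drop_upt
    by (simp_all del: upt_Suc add: add.commute)
  \<comment> \<open>The other cycles contribute even amounts to \<open>v\<close>, so the congruence
    for \<open>v\<close> becomes one for \<open>h\<close>.\<close>
  have "even (v + h)"
  proof -
    have "even (sum_list (map (\<lambda>i. 2 * l i) is))" for "is" by (induction "is") auto
    moreover have "even (sum_list (concat (map (\<lambda>j. [l j, l j]) js)))" for js by (induction js) auto
    ultimately show ?thesis unfolding assms(7,8) card_cycle_union by simp
  qed
  then have "even (int v + int h)" by presburger
  moreover have "even (int v - 1 - \<sigma>)" using cong by (simp add: cong_iff_dvd_diff)
  ultimately have "even (int h - (1 - \<sigma>))" by presburger
  then obtain q where q: "int h - (1 - \<sigma>) = 2 * q" by (rule evenE)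
  \<comment> \<open>Half of the given bound, because the long cycle covers the path twice.\<close>
  define X where "X = 7 ^ (s - 1) * (6 * int L + 3)"
  have "0 \<le> X" by (simp add: X_def)
  have "int (7 ^ (s - 1) * (12 * L + 6)) < int h" using assms(10) by (simp only: of_nat_less_iff)
  then have "2 * X < int h" by (simp add: X_def algebra_simps)
  \<comment> \<open>From \<open>2 * X + 1 \<le> h\<close> and \<open>1 - \<sigma> \<le> 2\<close>
    follows \<open>2 * q \<ge> 2 * X - 1\<close>, and integrality gives the claim.\<close>
  then have X: "X \<le> q" using q \<sigma> by auto
  define p where "p = nat q"
  have h: "h = 2 * p + nat (1 - \<sigma>)" and p: "int p = q"
    using q X \<open>0 \<le> X\<close> \<sigma> by (auto simp: p_def)
  have L: "L \<in> set ls" "\<forall>x\<in>set ls. x \<le> L"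
    using assms(2,9) by (auto simp: set_ls)
  \<comment> \<open>The order of the labelling is \<open>p\<close> plus all cycle lengths. The
    longest cycle alone provides the summand \<open>L\<close> required by
    \<open>blocks_exist\<close>.\<close>
  have "int L \<le> int (sum_list ls)" using member_le_sum_list[OF L(1)] by simp
  then have bound: "7 ^ (length ls - 1) * (6 * int L + 3) + int L \<le> int (p + sum_list ls)"
    using X p by (simp add: len_ls X_def)
  have nonempty: "ls \<noteq> []" using L(1) by auto
  have admissible: "\<forall>x\<in>set ls. odd x \<and> 3 \<le> x \<and> x \<le> L"
    using assms(4,5) L(2) by (auto simp: set_ls)
  from blocks_exist[OF nonempty admissible bound] obtain cs P
    where B: "block 0 (int (p + sum_list ls)) cs P" and cs: "map length cs = ls"
    by blast
  have "length P = p"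
    using B by (simp add: block_def length_concat cs)
  moreover have "3 \<le> X"
  proof -
    have "1 * 3 \<le> 7 ^ (s - 1) * (6 * int L + 3)" by (intro mult_mono) auto
    then show ?thesis by (simp add: X_def)
  qed
  then have "2 \<le> p" using X p by linarith
  ultimately have "has_pyramidal_solution (nat (1 - \<sigma>)) \<sigma>
      (cycle_union (h # map (\<lambda>c. 2 * length c) (take r cs) @
         concat (map (\<lambda>c. [length c, length c]) (drop r cs))))"
    using block_pyramidal[OF B _ \<sigma>, of r] by (simp add: h)
  moreover have "map (\<lambda>c. 2 * length c) (take r cs) = map (\<lambda>i. 2 * l i) [1..<r + 1]"
  proof -
    have "map (\<lambda>c. 2 * length c) (take r cs) = map (\<lambda>x. 2 * x) (take r ls)"
      by (simp add: take_map flip: cs)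
    then show ?thesis by (simp only: split(1) map_map comp_def)
  qed
  moreover have "map (\<lambda>c. [length c, length c]) (drop r cs) = map (\<lambda>j. [l j, l j]) [r + 1..<s + 1]"
  proof -
    have "map (\<lambda>c. [length c, length c]) (drop r cs) = map (\<lambda>x. [x, x]) (drop r ls)"
      by (simp add: drop_map flip: cs)
    then show ?thesis by (simp only: split(2) map_map comp_def)
  qed
  ultimately show "has_pyramidal_solution (nat (1 - \<sigma>)) \<sigma> F" using assms(7) by simp
qed

end
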